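(* Let $n\ge 1$ be an integer, let $\eta_{n,k}$ ($k=1,2,3,\dots$) be the zeros of the polygamma function $\psi^{(n)}(z)$, taken in increasing order of their modulus, and let $l_{n,k}$ be the order of the zero $\eta_{n,k}$. Then: (a) $$\sum_{k=1}^{\infty}\left(\frac{l_{n,k}}{\eta_{n,k}}+\frac{n+1}{k}\right)=0;$$ (b) for $2\le j\le n$, $$\sum_{k=1}^{\infty}\frac{l_{n,k}}{\eta_{n,k}^{\,j}}=(-1)^{j}(n+1)\,\zeta(j);$$ (c) for $n=1,2,3,\dots$, $$\sum_{k=1}^{\infty}\frac{l_{2n+1,k}}{\eta_{2n+1,k}^{\,2n+2}}=0,\qquad \sum_{k=1}^{\infty}\frac{l_{2n,k}}{\eta_{2n,k}^{\,2n+1}}=-2(2n+1)\,\zeta(2n+1).$$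
   Context: $\psi=\Gamma'/\Gamma$ is the digamma function and $\psi^{(n)}=\frac{d^n\psi}{dz^n}$, so that for $n\ge 1$, $\psi^{(n)}(z)=(-1)^{n+1}n!\sum_{m=0}^{\infty}\frac{1}{(z+m)^{n+1}}$, a meromorphic function on $\mathbb{C}$ with poles of order $n+1$ exactly at $z=0,-1,-2,\dots$. $\zeta$ is the Riemann zeta function.
   Formalization: In (a) the terms are not paired by index k (that series converges to (n+1)log(n+1), not 0); instead zeros and poles are summed jointly by modulus: sum of l_{n,k}/η_{n,k} over k≤K plus sum of (n+1)/m over 1≤m≤|η_{n,K}| tends to 0 as K→∞. *)

theory Defs
  imports "HOL-Complex_Analysis.Complex_Analysis"
begin

text \<open>
  At its poles \<open>0, -1, -2, \<dots>\<close> the library function \<^const>\<open>Polygamma\<close> takes a junk value,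
  so these points are excluded explicitly.
\<close>

definition polygamma_zeros :: "nat \<Rightarrow> complex set" where
  "polygamma_zeros n = {z. z \<notin> \<int>\<^sub>\<le>\<^sub>0 \<and> Polygamma n z = 0}"

text \<open>
  Each zero is listed exactly once, at an index \<open>k \<ge> 1\<close>; the value at index 0 is irrelevant.
  Non-real zeros come in conjugate pairs, so the modulus can only be required to be
  non-decreasing; zeros of equal modulus may be listed in any order.
\<close>

definition enumerates_polygamma_zeros :: "nat \<Rightarrow> (nat \<Rightarrow> complex) \<Rightarrow> bool" where
  "enumerates_polygamma_zeros n \<eta> \<longleftrightarrow>
     bij_betw \<eta> {1..} (polygamma_zeros n) \<and>
     (\<forall>i k. 1 \<le> i \<and> i \<le> k \<longrightarrow> norm (\<eta> i) \<le> norm (\<eta> k))"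

definition polygamma_zero_order :: "nat \<Rightarrow> complex \<Rightarrow> int" where
  "polygamma_zero_order n z = zorder (Polygamma n) z"

text \<open>
  The Dirichlet series of the Riemann zeta function. It represents the zeta function
  for \<open>Re s > 1\<close> only, which covers the arguments used here (integers at least 2).
\<close>

definition zeta :: "complex \<Rightarrow> complex" where
  "zeta s = (\<Sum>k. 1 / of_nat (Suc k) powr s)"

text \<open>
  Partial sums for the conditionally convergent series
  \<open>\<Sum>k. l\<^sub>k / \<eta>\<^sub>k + (n + 1) / k\<close>. The term \<open>(n + 1) / m\<close> comes from the pole of
  order \<open>n + 1\<close> at \<open>-m\<close>, so zeros and poles are summed jointly in increasing order of
  modulus: with the zeros \<open>\<eta>\<^sub>1, \<dots>, \<eta>\<^sub>K\<close> go the poles \<open>-m \<noteq> 0\<close> with \<open>m \<le> \<bar>\<eta>\<^sub>K\<bar>\<close>.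
  Pairing the \<open>k\<close>-th zero with the \<open>k\<close>-th pole is not an option: there are about
  \<open>(n + 1) R\<close> zeros of modulus at most \<open>R\<close> but only about \<open>R\<close> poles, so that this
  rearrangement would change the value of the sum from \<open>0\<close> to \<open>(n + 1) ln (n + 1)\<close>.
\<close>

definition zero_pole_partial_sum ::
    "nat \<Rightarrow> (nat \<Rightarrow> int) \<Rightarrow> (nat \<Rightarrow> complex) \<Rightarrow> nat \<Rightarrow> complex" where
  "zero_pole_partial_sum n l \<eta> K =
     (\<Sum>k = 1..K. of_int (l k) / \<eta> k) +
     (\<Sum>m = 1..nat \<lfloor>norm (\<eta> K)\<rfloor>. of_nat (n + 1) / of_nat m)"

end

theory Submission
  imports Defs "HOL-Real_Asymp.Real_Asymp"
begin

text \<open>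
  The sums are read off from the integral of \<open>\<psi>\<^sup>(\<^sup>n\<^sup>+\<^sup>1\<^sup>)(z) / (\<psi>\<^sup>(\<^sup>n\<^sup>)(z) z\<^sup>j)\<close> over large
  squares. In the right half-plane \<open>\<psi>\<^sup>(\<^sup>n\<^sup>)(z)\<close> behaves like a multiple of \<open>z\<^sup>-\<^sup>n\<close>; by the reflection formula
  so it does in the left half-plane wherever \<open>\<bar>Im z\<bar> \<ge> sqrt \<bar>z\<bar>\<close>, since there the derivatives of
  \<open>cot (\<pi> z)\<close> are exponentially small. Hence the integrand is \<open>o(1/\<bar>z\<bar>)\<close> except on a piece of length
  \<open>O(sqrt N)\<close> of the left edge, where it is \<open>O(1/N)\<close> provided that the fractional part of the abscissa
  is chosen such that the two terms of the reflection formula do not cancel. So the integrals tend to \<open>0\<close>.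
  All large zeros lie near the negative real axis, so the terms \<open>l/\<eta>\<close> have real parts of
  constant sign there, and the convergence along squares for \<open>j = 1\<close> already bounds the total contribution
  of the zeros between two neighbouring squares. This permits to pass from squares to the enumeration by modulus.
\<close>

section \<open>Asymptotics in the right half-plane\<close>

text \<open>The residues inside a square are l/eta^j at a zero, -(n+1)/(-m)^j at a pole -m with m >
  0, and at 0 a term that is nonzero only for j = n+1. Vanishing of the limit of the integrals
  therefore yields all three claims together: the poles produce the zeta value, and in (c) the
  residue at 0 cancels or doubles it according to the parity of n.

  The obstacle is the left edge. At heights of the order of log N the power decay of one term of the
  reflection formula meets the exponential decay of the other, and zeros can occur there. No lower
  bound for the gaps between the moduli of zeros is at hand, which speaks against circles. Vertical
  lines are better: the cotangent part has period 1, so moving a line by an integer does not change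
  it and bounds become uniform in N.

  The region |Im z| < sqrt |z| also matters for the enumeration: there |z| exceeds |Re z| by at most
  1, so squares and discs select nearly the same zeros.\<close>

lemma norm_add_of_nat_ge:
  fixes z :: complex
  assumes "Re z \<ge> 0"
  shows "norm (z + of_nat m) \<ge> norm z" "2 * norm (z + of_nat m) ^ 2 \<ge> (norm z + real m) ^ 2"
proof -
  have eq: "norm (z + of_nat m) ^ 2 = norm z ^ 2 + real m ^ 2 + 2 * (Re z * real m)"
    unfolding cmod_power2 by (simp add: power2_eq_square algebra_simps)
  have nn: "Re z * real m \<ge> 0"
    using assms by simp
  show "norm (z + of_nat m) \<ge> norm z"
    by (rule power2_le_imp_le) (use eq nn in auto)
  have "(norm z - real m) ^ 2 \<ge> 0"
    by simp
  thus "2 * norm (z + of_nat m) ^ 2 \<ge> (norm z + real m) ^ 2"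
    unfolding eq using nn by (simp add: power2_eq_square algebra_simps)
qed

text \<open>First-order Taylor expansion of u^(-n) with remainder. For Re u >= 0 the modulus on the
  segment from u to u + 1 is smallest at u, which bounds the second derivative along it.\<close>

lemma inverse_power_diff_bound:
  fixes u :: complex
  assumes "Re u \<ge> 0" "u \<noteq> 0"
  shows "norm (1 / u ^ n - 1 / (u + 1) ^ n - of_nat n / u ^ Suc n) \<le> real n * real (Suc n) / norm u ^ (n + 2)"
proof -
  define S where "S = closed_segment u (u + 1)"
  have nz: "norm x \<ge> norm u" "x \<noteq> 0" if "x \<in> S" for x
  proof -
    obtain t where t: "t \<ge> 0" "x = u + of_real t"
      using \<open>x \<in> S\<close> unfolding S_def in_segment by (auto simp: scaleR_conv_of_real algebra_simps)
    have "norm x ^ 2 = norm u ^ 2 + t ^ 2 + 2 * (Re u * t)"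
      unfolding t cmod_power2 by (simp add: power2_eq_square algebra_simps)
    moreover have "Re u * t \<ge> 0" using assms t by simp
    ultimately have "norm u ^ 2 \<le> norm x ^ 2" by simp
    thus "norm x \<ge> norm u"
      by (rule power2_le_imp_le) auto
    thus "x \<noteq> 0" using assms(2) by auto
  qed
  define f where "f = (\<lambda>(i::nat) x::complex. if i = 0 then x powi (- int n) 
     else if i = 1 then - of_nat n * x powi (- int n - 1)
     else of_nat n * of_nat (Suc n) * x powi (- int n - 2))"
  have "norm (f 0 (u+1) - (\<Sum>i\<le>1. f i u * ((u+1) - u) ^ i / fact i)) \<le>
          (real n * real (Suc n) / norm u ^ (n + 2)) * cmod ((u+1) - u) ^ Suc 1 / fact 1"
  proof (rule complex_Taylor)
    show "convex S" by (simp add: S_def)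
    show "(f i has_field_derivative f (Suc i) x) (at x within S)" if "x \<in> S" "i \<le> 1" for i x
    proof -
      have "i = 0 \<or> i = 1" using that by auto
      thus ?thesis using nz[OF that(1)]
        by (auto simp: f_def fun_eq_iff algebra_simps intro!: derivative_eq_intros)
    qed
    show "norm (f (Suc 1) x) \<le> real n * real (Suc n) / norm u ^ (n + 2)" if "x \<in> S" for x
    proof -
      have e: "- int n - 2 = - int (n + 2)" by simp
      have "norm (f (Suc 1) x) = real n * real (Suc n) / norm x ^ (n + 2)"
        unfolding f_def e power_int_minus power_int_of_nat
        by (simp add: norm_mult norm_inverse norm_power divide_inverse del: of_nat_Suc power_Suc)
      also have "\<dots> \<le> real n * real (Suc n) / norm u ^ (n + 2)"
        using nz[OF that] assms by (intro divide_left_mono power_mono mult_pos_pos) auto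
      finally show ?thesis .
    qed
  qed (auto simp: S_def)
  moreover have "f 0 (u+1) - (\<Sum>i\<le>1. f i u * ((u+1) - u) ^ i / fact i) = 
                 - (1 / u ^ n - 1 / (u + 1) ^ n - of_nat n / u ^ Suc n)"
  proof -
    have e: "- int n - 1 = - int (Suc n)" by simp
    show ?thesis unfolding f_def e power_int_minus power_int_of_nat
      by (simp add: divide_inverse)
  qed
  ultimately show ?thesis by (simp only: norm_minus_cancel) simp
qed

text \<open>
  The series of \<open>n / u\<^sup>n\<^sup>+\<^sup>1\<close> over \<open>u = z, z + 1, \<dots>\<close> is compared with the telescoping series of
  \<open>1 / u\<^sup>n - 1 / (u + 1)\<^sup>n\<close>.
\<close>

lemma norm_Polygamma_asymp:
  fixes z :: complex
  assumes "Re z \<ge> 0" "norm z > 1" "n > 0"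
  shows "norm ((-1) ^ Suc n * Polygamma n z * z ^ n - fact (n - 1)) \<le> fact n * (2 * real (Suc n) / (norm z - 1))"
proof -
  from assms have z0: "z \<noteq> 0" by auto
  define E where "E = (\<lambda>m. 1 / (z + of_nat m) ^ n - 1 / (z + of_nat m + 1) ^ n - of_nat n / (z + of_nat m) ^ Suc n)"
  \<comment> \<open>A telescoping majorant: D m - D (m + 1) = 2 / ((|z| + m - 1)(|z| + m)) dominates
    2 / (|z| + m)^2. Its sum D 0 = 2 / (|z| - 1) becomes the final bound, whence the hypothesis |z|
    > 1.\<close>
  define D where "D = (\<lambda>m. 2 / (norm z + real m - 1))"
  have D: "(\<lambda>m. D m - D (Suc m)) sums (D 0 - 0)"
    by (intro telescope_sums') (unfold D_def, real_asymp)
  have Ebound: "norm (E m) \<le> real n * real (Suc n) / norm z ^ n * (D m - D (Suc m))" for m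
  proof -
    note ge = norm_add_of_nat_ge[OF assms(1), of m]
    have nz: "z + of_nat m \<noteq> 0" using ge(1) assms(2) by auto
    have "norm (E m) \<le> real n * real (Suc n) / norm (z + of_nat m) ^ (n + 2)"
      unfolding E_def by (rule inverse_power_diff_bound) (use assms nz in auto)
    also have "\<dots> = (real n * real (Suc n)) * (1 / norm (z + of_nat m) ^ n * (1 / norm (z + of_nat m) ^ 2))"
      by (simp only: power_add) simp
    also have "\<dots> \<le> (real n * real (Suc n)) * (1 / norm z ^ n * (D m - D (Suc m)))"
    proof (intro mult_left_mono mult_mono)
      show "1 / norm (z + of_nat m) ^ n \<le> 1 / norm z ^ n"
        using ge z0 nz by (intro divide_left_mono power_mono mult_pos_pos) auto
      \<comment> \<open>In the right half-plane |z + m| can be traded for |z| + m at the cost of a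
        factor 2, uniformly up to the imaginary axis.\<close>
      have "1 / norm (z + of_nat m) ^ 2 \<le> 2 / (norm z + real m) ^ 2"
        using ge(2) nz assms(2) by (simp add: field_simps)
      also have "\<dots> \<le> 2 / ((norm z + real m - 1) * (norm z + real m))"
        unfolding power2_eq_square using assms(2) by (intro divide_left_mono mult_right_mono mult_pos_pos) auto
      also have "\<dots> = D m - D (Suc m)"
        unfolding D_def using assms(2) by (simp add: field_simps)
      finally show "1 / norm (z + of_nat m) ^ 2 \<le> D m - D (Suc m)" .
    qed auto
    finally show ?thesis by simp
  qed
  have Dsum: "(\<lambda>m. real n * real (Suc n) / norm z ^ n * (D m - D (Suc m))) sums
      (real n * real (Suc n) / norm z ^ n * D 0)"
    using sums_mult[OF D, of "real n * real (Suc n) / norm z ^ n"] unfolding diff_0_right .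
  have bE: "norm (suminf E) \<le> real n * real (Suc n) / norm z ^ n * D 0"
    by (rule norm_suminf_le[OF Ebound sums_summable[OF Dsum], folded sums_unique[OF Dsum]])
  have P: "(\<lambda>k. inverse ((z + of_nat k)^Suc n)) sums ((-1) ^ Suc n * Polygamma n z / fact n)"
    by (rule Polygamma_LIMSEQ) (use z0 assms in auto)
  have T: "(\<lambda>m. 1 / (z + of_nat m) ^ n - 1 / (z + of_nat (Suc m)) ^ n) sums (1 / (z + of_nat 0) ^ n - 0)"
  proof (rule telescope_sums')
    have "filterlim (\<lambda>m. z + of_nat m) at_infinity sequentially"
      by (rule tendsto_add_filterlim_at_infinity[OF tendsto_const tendsto_of_nat])
    from tendsto_power[OF filterlim_compose[OF tendsto_inverse_0 this], of n]
    have "(\<lambda>m. inverse ((z + of_nat m)) ^ n) \<longlonglongrightarrow> 0 ^ n" .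
    thus "(\<lambda>m. 1 / (z + of_nat m) ^ n) \<longlonglongrightarrow> 0"
      using assms(3) by (simp add: divide_inverse power_inverse zero_power)
  qed
  have "(\<lambda>m. (1 / (z + of_nat m) ^ n - 1 / (z + of_nat (Suc m)) ^ n) - of_nat n * inverse ((z + of_nat m)^Suc n))
      sums (1 / (z + of_nat 0) ^ n - 0 - of_nat n * ((-1) ^ Suc n * Polygamma n z / fact n))"
    by (intro sums_diff sums_mult T P)
  also have "(\<lambda>m. (1 / (z + of_nat m) ^ n - 1 / (z + of_nat (Suc m)) ^ n) - of_nat n * inverse ((z + of_nat m)^Suc n)) = E"
    by (simp add: E_def fun_eq_iff divide_inverse add_ac)
  finally have E: "suminf E = 1 / z ^ n - of_nat n * ((-1) ^ Suc n * Polygamma n z / fact n)"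
    by (simp add: sums_iff)
  have fct: "fact n = of_nat n * (fact (n - 1) :: complex)"
    using assms(3) by (simp add: fact_reduce)
  have fct': "fact n = real n * fact (n - 1)"
    using assms(3) by (simp add: fact_reduce)
  have "(-1) ^ Suc n * Polygamma n z * z ^ n - fact (n - 1) = - (fact (n - 1) * z ^ n * suminf E)"
    unfolding E using assms(3) z0 by (simp add: fct field_simps)
  also have "norm \<dots> = fact (n - 1) * norm z ^ n * norm (suminf E)"
    by (simp add: norm_mult norm_power)
  also have "\<dots> \<le> fact (n - 1) * norm z ^ n * (real n * real (Suc n) / norm z ^ n * D 0)"
    by (intro mult_left_mono bE) auto
  also have "\<dots> = fact n * (2 * real (Suc n) / (norm z - 1))"
    using z0 by (simp add: fct' D_def)
  finally show ?thesis .
qed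

text \<open>Limits along this filter are uniform in the argument of z, so they can be pulled back
  along z -> 1 - z and restricted to smaller regions by comparing filters.\<close>

definition right_half_at_infinity :: "complex filter" where
  "right_half_at_infinity = inf at_infinity (principal {z. Re z \<ge> 0})"

lemma tendsto_Polygamma_right_half:
  assumes "n > 0"
  shows "((\<lambda>z. Polygamma n z * z ^ n) \<longlongrightarrow> (-1) ^ Suc n * fact (n - 1)) right_half_at_infinity"
proof -
  have lim: "((\<lambda>z::complex. fact n * (2 * real (Suc n) / (norm z - 1))) \<longlongrightarrow> 0) right_half_at_infinity"
  proof (rule tendsto_mono[where F' = at_infinity])
    have "((\<lambda>x. fact n * (2 * real (Suc n) / (x - 1))) \<longlongrightarrow> 0) at_top"
      by real_asymp
    from filterlim_compose[OF this filterlim_norm_at_top]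
    show "((\<lambda>z::complex. fact n * (2 * real (Suc n) / (norm z - 1))) \<longlongrightarrow> 0) at_infinity" .
  qed (auto simp: right_half_at_infinity_def)
  have "((\<lambda>z. (-1) ^ Suc n * Polygamma n z * z ^ n - fact (n - 1)) \<longlongrightarrow> (0::complex)) right_half_at_infinity"
  proof (rule Lim_null_comparison[OF _ lim])
    have "eventually (\<lambda>z::complex. norm z > 1) at_infinity"
      using filterlim_norm_at_top filterlim_at_top_dense by blast
    thus "\<forall>\<^sub>F z in right_half_at_infinity. norm ((-1) ^ Suc n * Polygamma n z * z ^ n - fact (n - 1))
        \<le> fact n * (2 * real (Suc n) / (norm z - 1))"
      unfolding right_half_at_infinity_def eventually_inf_principal
      by eventually_elim (use norm_Polygamma_asymp assms in auto)
  qed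
  hence "((\<lambda>z. (-1) ^ Suc n * Polygamma n z * z ^ n) \<longlongrightarrow> (fact (n - 1) :: complex)) right_half_at_infinity"
    by (rule LIM_zero_cancel)
  from tendsto_mult_left[OF this, of "(-1) ^ Suc n"] show ?thesis
    by (cases "even n") (simp_all add: minus_one_power_iff)
qed

section \<open>The reflection formula\<close>

text \<open>Off the integers this is the n-th derivative of pi cot(pi z). In its polygamma form,
  differentiation and translation by 1 follow from the rules for \<open>Polygamma\<close>.\<close>

definition polygamma_reflection :: "nat \<Rightarrow> complex \<Rightarrow> complex" where
  "polygamma_reflection n z = (-1) ^ n * Polygamma n (1 - z) - Polygamma n z"

lemma not_Ints_imp_not_nonpos_Ints:
  fixes z :: complex
  assumes "z \<notin> \<int>"
  shows "z \<notin> \<int>\<^sub>\<le>\<^sub>0" "1 - z \<notin> \<int>\<^sub>\<le>\<^sub>0"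
proof -
  show "z \<notin> \<int>\<^sub>\<le>\<^sub>0"
    using assms nonpos_Ints_Int by blast
  have "1 - z \<in> \<int> \<Longrightarrow> 1 - (1 - z) \<in> \<int>"
    by (rule Ints_diff) auto
  thus "1 - z \<notin> \<int>\<^sub>\<le>\<^sub>0"
    using assms nonpos_Ints_Int by auto
qed

lemma has_field_derivative_polygamma_reflection [derivative_intros]:
  assumes "z \<notin> \<int>"
  shows "(polygamma_reflection n has_field_derivative polygamma_reflection (Suc n) z) (at z)"
  unfolding polygamma_reflection_def
  by (rule derivative_eq_intros DERIV_chain'[where g = "Polygamma n"] refl
        not_Ints_imp_not_nonpos_Ints[OF assms])+ simp

text \<open>Logarithmic differentiation of rGamma(z) rGamma(1 - z) = sin(pi z) / pi.\<close>

lemma polygamma_reflection_0: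
  assumes "z \<notin> \<int>"
  shows "polygamma_reflection 0 z = of_real pi * cot (of_real pi * z)"
proof -
  note nz = not_Ints_imp_not_nonpos_Ints[OF assms]
  have "((\<lambda>z. rGamma z * rGamma (1 - z)) has_field_derivative
          rGamma z * rGamma (1 - z) * polygamma_reflection 0 z) (at z)"
    by (rule derivative_eq_intros DERIV_chain'[where g = rGamma] refl nz)+
       (simp add: polygamma_reflection_def algebra_simps)
  moreover have "((\<lambda>z. rGamma z * rGamma (1 - z)) has_field_derivative cos (of_real pi * z)) (at z)"
    unfolding rGamma_reflection_complex by (auto intro!: derivative_eq_intros)
  ultimately have "sin (of_real pi * z) / of_real pi * polygamma_reflection 0 z = cos (of_real pi * z)"
    unfolding rGamma_reflection_complex[symmetric] by (rule DERIV_unique)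
  moreover have "sin (of_real pi * z) \<noteq> 0"
    using rGamma_reflection_complex[of z] nz by (auto simp: rGamma_eq_zero_iff)
  ultimately show ?thesis
    by (simp add: cot_def field_simps)
qed

text \<open>The recurrence contributes multiples of (z - 1)^(-n-1) and (1 - z)^(-n-1); the sign
  (-1)^n in \<open>polygamma_reflection\<close> is what makes them cancel.\<close>

lemma polygamma_reflection_minus_1:
  assumes "z \<notin> \<int>"
  shows "polygamma_reflection n (z - 1) = polygamma_reflection n z"
proof -
  have "z - 1 \<noteq> 0" "1 - z \<noteq> 0"
    using assms by auto
  hence "Polygamma n z = Polygamma n (z - 1) + (-1) ^ n * fact n / (z - 1) ^ Suc n"
        "Polygamma n (2 - z) = Polygamma n (1 - z) + (-1) ^ n * fact n / (1 - z) ^ Suc n"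
    using Polygamma_plus1[of "z - 1" n] Polygamma_plus1[of "1 - z" n] by (simp_all add: algebra_simps)
  moreover have "(1 - z) ^ Suc n = (-1) ^ Suc n * (z - 1) ^ Suc n"
    unfolding power_mult_distrib[symmetric] by simp
  moreover have "1 - (z - 1) = 2 - z"
    by simp
  ultimately show ?thesis
    by (cases "even n") (simp_all add: polygamma_reflection_def minus_one_power_iff)
qed

text \<open>The cotangent part on the line Re z = x - N is thus the one on the fixed line Re z = x,
  which makes the later estimates uniform in N.\<close>

lemma polygamma_reflection_minus_of_nat:
  assumes "z \<notin> \<int>"
  shows "polygamma_reflection n (z - of_nat m) = polygamma_reflection n z"
proof (induction m)
  case (Suc m)
  have "z - of_nat m \<notin> \<int>"
  proof
    assume "z - of_nat m \<in> \<int>"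
    hence "z - of_nat m + of_nat m \<in> \<int>"
      by (intro Ints_add) auto
    thus False using assms by simp
  qed
  from polygamma_reflection_minus_1[OF this, of n] Suc.IH show ?case
    by (simp add: algebra_simps)
qed simp

text \<open>
  In terms of \<open>w = exp (2 \<pi> \<i> z)\<close>, we have \<open>cot (\<pi> z) = \<i> (w + 1) / (w - 1)\<close>, and \<open>d/dz\<close> becomes
  \<open>2 \<pi> \<i> w d/dw\<close>.
\<close>

primrec cot_kernel :: "nat \<Rightarrow> complex \<Rightarrow> complex" where
  "cot_kernel 0 = (\<lambda>w. (w + 1) / (w - 1))"
| "cot_kernel (Suc n) = (\<lambda>w. w * deriv (cot_kernel n) w)"

lemma holomorphic_cot_kernel: "cot_kernel n holomorphic_on ball 0 1"
  by (induction n) (auto intro!: holomorphic_intros)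

text \<open>The derivative of w f'(w) at 0 is f'(0), so w d/dw preserves the linear coefficient.
  This -2 supplies the leading term for w -> 0, that is for Im z -> infinity.\<close>

lemma deriv_cot_kernel_0: "deriv (cot_kernel n) 0 = -2"
proof (induction n)
  case 0
  have "(cot_kernel 0 has_field_derivative -2) (at 0)"
    by (auto intro!: derivative_eq_intros)
  thus ?case by (rule DERIV_imp_deriv)
next
  case (Suc n)
  have "deriv (cot_kernel n) holomorphic_on ball 0 1"
    by (intro holomorphic_deriv holomorphic_cot_kernel) auto
  hence "(deriv (cot_kernel n) has_field_derivative deriv (deriv (cot_kernel n)) 0) (at 0)"
    by (rule holomorphic_derivI) auto
  hence "(cot_kernel (Suc n) has_field_derivative -2) (at 0)"
    by (auto intro!: derivative_eq_intros simp: Suc.IH)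
  thus ?case by (rule DERIV_imp_deriv)
qed

lemma Im_pos_not_Ints: "Im z > 0 \<Longrightarrow> z \<notin> \<int>"
  by (auto simp: complex_is_Int_iff)

text \<open>Induction by differentiating the identity for n on the open half-plane. Im z > 0 puts w
  into the unit disc, away from the pole of \<open>cot_kernel 0\<close> at 1.\<close>

lemma polygamma_reflection_upper:
  assumes "Im z > 0"
  shows "polygamma_reflection n z = of_real pi * \<i> * (2 * of_real pi * \<i>) ^ n * cot_kernel n (exp (2 * of_real pi * \<i> * z))"
  using assms
proof (induction n arbitrary: z)
  case (0 z)
  define e where "e = exp (\<i> * (of_real pi * z))"
  have w: "exp (2 * of_real pi * \<i> * z) = e * e"
    unfolding e_def by (simp flip: exp_add add: algebra_simps)
  have e': "exp (-(\<i> * (of_real pi * z))) = inverse e"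
    by (simp add: e_def exp_minus)
  have "norm (e * e) < 1"
    using 0 unfolding w[symmetric] by simp
  hence "e * e \<noteq> 1" by auto
  moreover have "e \<noteq> 0" by (simp add: e_def)
  ultimately have "cot (of_real pi * z) = \<i> * ((e * e + 1) / (e * e - 1))"
    unfolding cot_def cos_exp_eq sin_exp_eq e' e_def[symmetric] by (simp add: field_simps)
  thus ?case
    using polygamma_reflection_0[OF Im_pos_not_Ints[OF 0]] by (simp add: w)
next
  case (Suc n z)
  define W where "W = exp (2 * of_real pi * \<i> * z)"
  have W: "W \<in> ball 0 1"
    using Suc.prems unfolding W_def by simp
  have "(cot_kernel n has_field_derivative deriv (cot_kernel n) W) (at W)"
    by (rule holomorphic_derivI[OF holomorphic_cot_kernel _ W]) auto
  note this[unfolded W_def]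
  moreover have "((\<lambda>z. exp (2 * of_real pi * \<i> * z)) has_field_derivative W * (2 * of_real pi * \<i>)) (at z)"
    by (auto intro!: derivative_eq_intros simp: W_def)
  ultimately have "((\<lambda>z. cot_kernel n (exp (2 * of_real pi * \<i> * z))) has_field_derivative
           deriv (cot_kernel n) W * (W * (2 * of_real pi * \<i>))) (at z)"
    unfolding W_def by (intro DERIV_chain2[where f = "cot_kernel n"])
  from DERIV_cmult[OF this, of "of_real pi * \<i> * (2 * of_real pi * \<i>) ^ n"]
  have "((\<lambda>z. of_real pi * \<i> * (2 * of_real pi * \<i>) ^ n * cot_kernel n (exp (2 * of_real pi * \<i> * z)))
      has_field_derivative (of_real pi * \<i> * (2 * of_real pi * \<i>) ^ Suc n * cot_kernel (Suc n) W)) (at z)"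
    by (rule DERIV_cong) simp
  hence "(polygamma_reflection n has_field_derivative (of_real pi * \<i> * (2 * of_real pi * \<i>) ^ Suc n * cot_kernel (Suc n) W)) (at z)"
    by (rule has_field_derivative_transform_within_open[where S = "{z. Im z > 0}"])
       (use Suc in \<open>auto simp: open_halfspace_Im_gt\<close>)
  with has_field_derivative_polygamma_reflection[OF Im_pos_not_Ints[OF Suc.prems]]
  show ?case unfolding W_def by (rule DERIV_unique)
qed

text \<open>The filter constrains Im z only, so the limit is uniform in Re z.\<close>

lemma tendsto_polygamma_reflection_upper:
  assumes "n > 0"
  shows "((\<lambda>z. polygamma_reflection n z / exp (2 * of_real pi * \<i> * z)) \<longlongrightarrow> -((2 * of_real pi * \<i>) ^ Suc n))
           (filtercomap Im at_top)"
proof -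
  \<comment> \<open>For n > 0 the kernel is w times \<open>deriv (cot_kernel m)\<close>, so division
    by w leaves a function that is continuous at 0 with value -2. For n = 0 the constant term of the
    cotangent would survive and the quotient would blow up.\<close>
  obtain m where m: "n = Suc m" using assms by (cases n) auto
  define F where "F = (filtercomap Im at_top :: complex filter)"
  have "((\<lambda>z. norm (exp (2 * of_real pi * \<i> * z))) \<longlongrightarrow> 0) F"
  proof -
    have "((\<lambda>y. exp (- (2 * pi * y))) \<longlongrightarrow> 0) at_top"
      by real_asymp
    from filterlim_compose[OF this filterlim_filtercomap, of Im]
    show ?thesis by (simp add: F_def)
  qed
  hence lim: "((\<lambda>z. exp (2 * of_real pi * \<i> * z)) \<longlongrightarrow> 0) F"
    by (rule tendsto_norm_zero_cancel)
  have "isCont (deriv (cot_kernel m)) 0"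
    by (intro analytic_at_imp_isCont analytic_deriv holomorphic_on_imp_analytic_at[OF holomorphic_cot_kernel[of m]]) auto
  from isCont_tendsto_compose[OF this lim] 
  have "((\<lambda>z. of_real pi * \<i> * (2 * of_real pi * \<i>) ^ n * deriv (cot_kernel m) (exp (2 * of_real pi * \<i> * z))) \<longlongrightarrow> 
          of_real pi * \<i> * (2 * of_real pi * \<i>) ^ n * (-2)) F"
    by (intro tendsto_intros) (simp add: deriv_cot_kernel_0)
  moreover have "eventually (\<lambda>z. Im z > 0) F"
    unfolding F_def by (rule eventually_filtercomapI[OF eventually_gt_at_top])
  hence "eventually (\<lambda>z. of_real pi * \<i> * (2 * of_real pi * \<i>) ^ n * deriv (cot_kernel m) (exp (2 * of_real pi * \<i> * z)) =
      polygamma_reflection n z / exp (2 * of_real pi * \<i> * z)) F"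
    by eventually_elim (simp add: polygamma_reflection_upper m)
  ultimately show ?thesis
    unfolding F_def[symmetric] by (subst (asm) tendsto_cong) (auto simp: algebra_simps)
qed

section \<open>The logarithmic derivative away from the negative real axis\<close>

text \<open>f behaves like c u^(-n) and g is O(|u|^(-n-1)), so the quotient is O(1/|u|). The scale u
  is kept abstract because it is z in the right half-plane and 1 - z in the left one.\<close>

lemma quotient_tendsto_0_of_power_asymp:
  fixes f g u :: "'a \<Rightarrow> complex"
  assumes "((\<lambda>z. f z * u z ^ n) \<longlongrightarrow> c) F" "c \<noteq> 0" "((\<lambda>z. g z * u z ^ Suc n) \<longlongrightarrow> d) F"
      and "filterlim u at_infinity F"
  shows "((\<lambda>z. g z / f z) \<longlongrightarrow> 0) F" "eventually (\<lambda>z. f z \<noteq> 0) F"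
proof -
  have "((\<lambda>z. g z * u z ^ Suc n / (f z * u z ^ n) * inverse (u z)) \<longlongrightarrow> d / c * 0) F"
    using assms by (intro tendsto_intros filterlim_compose[OF tendsto_inverse_0 assms(4)])
  moreover have "eventually (\<lambda>z. u z \<noteq> 0) F"
    using assms(4) by (rule filterlim_at_infinity_imp_eventually_ne)
  hence "eventually (\<lambda>z. g z * u z ^ Suc n / (f z * u z ^ n) * inverse (u z) = g z / f z) F"
    by eventually_elim (simp add: field_simps)
  ultimately show "((\<lambda>z. g z / f z) \<longlongrightarrow> 0) F"
    by (subst (asm) tendsto_cong) auto
  have "eventually (\<lambda>z. f z * u z ^ n \<noteq> 0) F"
    using assms(1,2) by (rule tendsto_imp_eventually_ne)
  thus "eventually (\<lambda>z. f z \<noteq> 0) F"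
    by eventually_elim auto
qed

text \<open>Transfers estimates to the lower half-plane from the upper one, where exp(2 pi i z)
  decays. The coefficients of the defining series are real.\<close>

lemma Polygamma_cnj:
  assumes "z \<noteq> 0" "n > 0"
  shows "Polygamma n (cnj z) = cnj (Polygamma n z)"
proof -
  have "(\<lambda>k. cnj (inverse ((z + of_nat k) ^ Suc n))) sums cnj ((-1) ^ Suc n * Polygamma n z / fact n)"
    using Polygamma_LIMSEQ[OF assms] by (subst sums_cnj)
  moreover have "(\<lambda>k. inverse ((cnj z + of_nat k) ^ Suc n)) sums ((-1) ^ Suc n * Polygamma n (cnj z) / fact n)"
    by (rule Polygamma_LIMSEQ) (use assms in auto)
  ultimately have "(-1) ^ Suc n * Polygamma n (cnj z) / fact n = cnj ((-1) ^ Suc n * Polygamma n z / fact n)"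
    using sums_unique2 by (fastforce simp del: power_Suc)
  thus ?thesis by simp
qed

lemma filterlim_const_minus_at_infinity:
  "filterlim (\<lambda>z. c - z) at_infinity (at_infinity :: 'a :: real_normed_vector filter)"
proof -
  have "filterlim (\<lambda>z::'a. - norm c + norm z) at_top at_infinity"
    by (rule filterlim_tendsto_add_at_top[OF tendsto_const filterlim_norm_at_top])
  hence "filterlim (\<lambda>z::'a. norm (c - z)) at_top at_infinity"
  proof (rule filterlim_at_top_mono)
    have "- norm c + norm z \<le> norm (c - z)" for z
      using norm_triangle_ineq2[of z c] by (simp add: norm_minus_commute)
    thus "eventually (\<lambda>z. - norm c + norm z \<le> norm (c - z)) at_infinity"
      by simp
  qed
  thus ?thesis
    by (subst filterlim_at_infinity_conv_norm_at_top)
qed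

text \<open>The height sqrt |z| is large enough for exp(-2 pi Im z) to beat every power of |z|, and
  small enough for the excluded part of a left edge of length 2N to have length O(sqrt N).\<close>

definition upper_left_at_infinity :: "complex filter" where
  "upper_left_at_infinity = inf at_infinity (principal {z. Re z \<le> 0 \<and> Im z \<ge> sqrt (norm z)})"

text \<open>Powers of 1 - z are the natural scale: 1 - z lies in the right half-plane, where the
  asymptotics are known, and the cotangent part is negligible against them. The constant is (-1)^n
  (-1)^(n+1) (n-1)!.\<close>

lemma tendsto_Polygamma_upper_left:
  assumes "n > 0"
  shows "((\<lambda>z. Polygamma n z * (1 - z) ^ n) \<longlongrightarrow> - fact (n - 1)) upper_left_at_infinity"
proof -
  define F where "F = upper_left_at_infinity"
  define E where "E = (\<lambda>z. exp (2 * of_real pi * \<i> * z))"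
  have norm_top: "filterlim norm at_top F"
    unfolding F_def upper_left_at_infinity_def
    by (rule filterlim_mono[OF filterlim_norm_at_top]) auto
  have evF: "eventually (\<lambda>z. Re z \<le> 0 \<and> Im z \<ge> sqrt (norm z)) F"
    unfolding F_def upper_left_at_infinity_def by (auto simp: eventually_inf_principal)
  have "filterlim (\<lambda>z. sqrt (norm z)) at_top F"
    by (rule filterlim_compose[OF sqrt_at_top norm_top])
  hence Im: "filterlim Im at_top F"
    by (rule filterlim_at_top_mono) (use evF in eventually_elim, auto)
  hence Im': "F \<le> filtercomap Im at_top"
    by (simp add: filterlim_iff_le_filtercomap)
  have u: "filterlim (\<lambda>z. 1 - z) right_half_at_infinity F"
    unfolding right_half_at_infinity_def filterlim_inf filterlim_principal
  proof
    have "F \<le> at_infinity"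
      by (simp add: F_def upper_left_at_infinity_def)
    thus "filterlim (\<lambda>z. 1 - z) at_infinity F"
      using filterlim_const_minus_at_infinity filterlim_mono by blast
    show "\<forall>\<^sub>F x in F. 1 - x \<in> {z. 0 \<le> Re z}"
      using evF by eventually_elim auto
  qed
  have "((\<lambda>z. E z * (1 - z) ^ n) \<longlongrightarrow> 0) F"
  proof (rule Lim_null_comparison)
    have "((\<lambda>x. exp (-(2 * pi * sqrt x)) * (1 + x) ^ n) \<longlongrightarrow> 0) at_top"
      by real_asymp
    from filterlim_compose[OF this norm_top]
    show "((\<lambda>z. exp (-(2 * pi * sqrt (norm z))) * (1 + norm z) ^ n) \<longlongrightarrow> 0) F" .
    show "\<forall>\<^sub>F z in F. norm (E z * (1 - z) ^ n) \<le> exp (-(2 * pi * sqrt (norm z))) * (1 + norm z) ^ n"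
      using evF
    proof eventually_elim
      case (elim z)
      have "norm (1 - z) \<le> 1 + norm z"
        using norm_triangle_ineq4[of 1 z] by simp
      moreover have "norm (E z) \<le> exp (-(2 * pi * sqrt (norm z)))"
        using elim by (simp add: E_def)
      ultimately show ?case
        unfolding norm_mult norm_power by (intro mult_mono power_mono) auto
    qed
  qed
  with tendsto_mono[OF Im' tendsto_polygamma_reflection_upper[OF assms]]
  have "((\<lambda>z. polygamma_reflection n z / E z * (E z * (1 - z) ^ n)) \<longlongrightarrow> -((2 * of_real pi * \<i>) ^ Suc n) * 0) F"
    unfolding E_def by (intro tendsto_mult)
  with filterlim_compose[OF tendsto_Polygamma_right_half[OF assms] u]
  have "((\<lambda>z. (-1) ^ n * (Polygamma n (1 - z) * (1 - z) ^ n) - polygamma_reflection n z / E z * (E z * (1 - z) ^ n)) \<longlongrightarrow>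
          (-1) ^ n * ((-1) ^ Suc n * fact (n - 1)) - (-((2 * of_real pi * \<i>) ^ Suc n) * 0)) F"
    by (intro tendsto_diff tendsto_mult_left)
  moreover have "(-1) ^ n * (Polygamma n (1 - z) * (1 - z) ^ n) - polygamma_reflection n z / E z * (E z * (1 - z) ^ n) =
                 Polygamma n z * (1 - z) ^ n" for z
  proof -
    have "polygamma_reflection n z / E z * (E z * (1 - z) ^ n) = polygamma_reflection n z * (1 - z) ^ n"
      by (simp add: E_def)
    thus ?thesis
      by (simp add: polygamma_reflection_def algebra_simps)
  qed
  ultimately show ?thesis
    unfolding F_def by (cases "even n") simp_all
qed

lemma Polygamma_ratio_small:
  assumes "n > 0" "\<epsilon> > 0"
  obtains R where "R > 0"
    "\<And>z::complex. norm z \<ge> R \<Longrightarrow> Re z \<ge> 0 \<or> \<bar>Im z\<bar> \<ge> sqrt (norm z) \<Longrightarrow> 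
       Polygamma n z \<noteq> 0 \<and> norm (Polygamma (Suc n) z / Polygamma n z) \<le> \<epsilon>"
proof -
  define Q where "Q = (\<lambda>z::complex. Polygamma n z \<noteq> 0 \<and> norm (Polygamma (Suc n) z / Polygamma n z) < \<epsilon>)"
  have Q: "eventually Q F" 
    if "((\<lambda>z::complex. Polygamma (Suc n) z / Polygamma n z) \<longlongrightarrow> 0) F" "eventually (\<lambda>z::complex. Polygamma n z \<noteq> 0) F" for F
    using that(2) order_tendstoD(2)[OF tendsto_norm_zero[OF that(1)] assms(2)]
    by eventually_elim (auto simp: Q_def)
  have "filterlim (\<lambda>z. z) at_infinity right_half_at_infinity"
    by (simp add: filterlim_def right_half_at_infinity_def)
  from quotient_tendsto_0_of_power_asymp[OF tendsto_Polygamma_right_half[OF assms(1)] _ tendsto_Polygamma_right_half this]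
  have 1: "eventually Q right_half_at_infinity"
    by (intro Q) auto
  have "filterlim (\<lambda>z::complex. 1 - z) at_infinity upper_left_at_infinity"
    by (rule filterlim_mono[OF filterlim_const_minus_at_infinity]) (auto simp: upper_left_at_infinity_def)
  from quotient_tendsto_0_of_power_asymp[OF tendsto_Polygamma_upper_left[OF assms(1)] _ tendsto_Polygamma_upper_left this]
  have 2: "eventually Q upper_left_at_infinity"
    by (intro Q) auto
  obtain R1 R2 where R1: "\<And>z. norm z \<ge> R1 \<Longrightarrow> Re z \<ge> 0 \<Longrightarrow> Q z"
    and R2: "\<And>z. norm z \<ge> R2 \<Longrightarrow> Re z \<le> 0 \<Longrightarrow> Im z \<ge> sqrt (norm z) \<Longrightarrow> Q z"
    using 1 2 unfolding right_half_at_infinity_def upper_left_at_infinity_def eventually_inf_principal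
      eventually_at_infinity by auto
  \<comment> \<open>The lower part of the left half-plane, by conjugation; the 1 in the threshold
    excludes z = 0, as \<open>Polygamma_cnj\<close> demands.\<close>
  have R3: "Q z" if "norm z \<ge> max 1 R2" "Re z \<le> 0" "-Im z \<ge> sqrt (norm z)" for z
  proof -
    have "Q (cnj z)" by (rule R2) (use that in auto)
    moreover have "z \<noteq> 0" using that by auto
    ultimately show ?thesis
      using assms unfolding Q_def by (simp add: Polygamma_cnj flip: complex_cnj_divide)
  qed
  show ?thesis
  proof (rule that[of "max 1 (max R1 R2)"])
    fix z assume "norm z \<ge> max 1 (max R1 R2)" "Re z \<ge> 0 \<or> \<bar>Im z\<bar> \<ge> sqrt (norm z)"
    hence "Q z" using R1[of z] R2[of z] R3[of z] by (cases "Re z \<ge> 0"; cases "Im z \<ge> 0") auto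
    thus "Polygamma n z \<noteq> 0 \<and> norm (Polygamma (Suc n) z / Polygamma n z) \<le> \<epsilon>"
      by (auto simp: Q_def)
  qed auto
qed

section \<open>The logarithmic derivative on vertical lines\<close>

lemma open_imp_fsigma:
  fixes S :: "'a :: euclidean_space set"
  assumes "open S"
  shows "fsigma S"
proof (cases "S = {}")
  case True
  thus ?thesis using fsigma.intros[of "\<lambda>_. {}"] by simp
next
  case False
  obtain D where D: "countable D" "D \<subseteq> Pow S" "\<And>X. X \<in> D \<Longrightarrow> \<exists>a b. X = cbox a b" "\<Union>D = S"
    by (rule open_countable_Union_open_cbox[OF assms]) blast
  have "D \<noteq> {}" using D False by auto
  with D have "range (from_nat_into D) = D"
    by (intro range_from_nat_into)
  moreover have "closed (from_nat_into D i)" for i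
    using D(3)[OF from_nat_into[OF \<open>D \<noteq> {}\<close>, of i]] by (auto simp: closed_cbox)
  ultimately show ?thesis
    using fsigma.intros[of "from_nat_into D"] D(4) by simp
qed

lemma connected_open_Compl_Ints: "connected (-\<int> :: complex set)" "open (-\<int> :: complex set)"
proof -
  have "countable (\<int> :: complex set)"
    by (simp add: Ints_def)
  from connected_open_diff_countable[OF _ open_UNIV connected_UNIV this]
  show "connected (-\<int> :: complex set)"
    by (simp add: Compl_eq_Diff_UNIV)
  show "open (-\<int> :: complex set)"
    by (simp add: open_Compl)
qed

text \<open>Countability is what lets a vertical line avoid all these zeros. Nonconstancy is read
  off on the imaginary axis: there the function decays like exp(-2 pi y) but is eventually nonzero,
  which no constant can do.\<close>

lemma countable_zeros_polygamma_reflection: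
  assumes "n > 0"
  shows "countable {z \<in> -\<int>. polygamma_reflection n z = 0}"
proof (rule holomorphic_countable_zeros)
  show "polygamma_reflection n holomorphic_on -\<int>"
    using has_field_derivative_polygamma_reflection
    by (subst holomorphic_on_open) (auto simp: connected_open_Compl_Ints)
  show "fsigma (-\<int> :: complex set)"
    by (rule open_imp_fsigma) (rule connected_open_Compl_Ints)
  show "\<not> polygamma_reflection n constant_on -\<int>"
  proof
    assume "polygamma_reflection n constant_on -\<int>"
    then obtain c where c: "\<And>z. z \<notin> \<int> \<Longrightarrow> polygamma_reflection n z = c"
      by (auto simp: constant_on_def)
    define E where "E = (\<lambda>y. exp (2 * of_real pi * \<i> * (\<i> * of_real y)) :: complex)"
    have "filterlim (\<lambda>y. \<i> * of_real y) (filtercomap Im at_top) at_top"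
      by (simp add: filterlim_filtercomap_iff o_def filterlim_ident)
    from filterlim_compose[OF tendsto_polygamma_reflection_upper[OF assms] this]
    have lim: "((\<lambda>y. polygamma_reflection n (\<i> * of_real y) / E y) \<longlongrightarrow> - ((2 * of_real pi * \<i>) ^ Suc n)) at_top"
      by (simp only: E_def)
    have "((\<lambda>y. exp (- (2 * pi * y))) \<longlongrightarrow> 0) at_top"
      by real_asymp
    hence E0: "(E \<longlongrightarrow> 0) at_top"
      by (intro tendsto_norm_zero_cancel[where f = E]) (simp add: E_def)
    have ev: "eventually (\<lambda>y. polygamma_reflection n (\<i> * of_real y) = c) at_top"
      using eventually_gt_at_top[of 0] by eventually_elim (auto intro!: c Im_pos_not_Ints)
    have "((\<lambda>y. polygamma_reflection n (\<i> * of_real y) / E y * E y) \<longlongrightarrow> - ((2 * of_real pi * \<i>) ^ Suc n) * 0) at_top"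
      by (intro tendsto_mult lim E0)
    moreover have "((\<lambda>y. polygamma_reflection n (\<i> * of_real y) / E y * E y) \<longlongrightarrow> c) at_top"
      by (rule tendsto_eventually) (use ev in eventually_elim, simp add: E_def)
    ultimately have "c = 0"
      using tendsto_unique by force
    moreover have "eventually (\<lambda>y. polygamma_reflection n (\<i> * of_real y) / E y \<noteq> 0) at_top"
      by (rule tendsto_imp_eventually_ne[OF lim]) auto
    from eventually_conj[OF this ev] have "c \<noteq> 0"
      using eventually_happens[of _ "at_top :: real filter"] by force
    ultimately show False by simp
  qed
qed (auto simp: connected_open_Compl_Ints)

text \<open>On the open interval exp(2 pi i x) takes every direction except 1. The endpoints are
  left out because x = 0 would put the vertical line through a pole.\<close>

lemma exists_rotation_Re_pos:
  fixes c :: complex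
  assumes "c \<noteq> 0"
  shows "\<exists>x\<in>{0<..<1}. Re (exp (2 * of_real pi * \<i> * of_real x) * c) > 0"
proof -
  have eq: "Re (exp (2 * of_real pi * \<i> * of_real x) * c) = cos (2 * pi * x) * Re c - sin (2 * pi * x) * Im c" for x :: real
    by (simp add: Re_exp Im_exp)
  consider "Re c < 0" | "Im c < 0" | "Im c > 0" | "Re c > 0" "Im c = 0"
    using assms by (metis complex.expand linorder_neqE_linordered_idom zero_complex.simps)
  thus ?thesis
  proof cases
    case 1
    thus ?thesis unfolding eq by (intro bexI[of _ "1/2"]) auto
  next
    case 2
    thus ?thesis unfolding eq by (intro bexI[of _ "1/4"]) auto
  next
    case 3
    have "2 * pi * (3 / 4) = 3 / 2 * pi" by simp
    thus ?thesis unfolding eq using 3 by (intro bexI[of _ "3/4"]) (simp_all only: cos_3over2_pi sin_3over2_pi, simp_all)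
  next
    case 4
    \<comment> \<open>The obvious choice x = 0 is not in the interval; since Im c = 0, an eighth of
      a turn keeps the real part positive.\<close>
    have "2 * pi * (1 / 8) = pi / 4" by simp
    thus ?thesis unfolding eq using 4 by (intro bexI[of _ "1/8"]) (simp_all add: cos_45)
  qed
qed

text \<open>
  On the line \<open>Re z = x\<close>, the positivity condition says that the leading term of
  \<open>polygamma_reflection n\<close> for \<open>Im z \<rightarrow> \<infinity>\<close> has positive real part. So has
  \<open>(-1)\<^sup>n\<^sup>+\<^sup>1 Polygamma n (1 - z)\<close> far to the left, and up to sign \<open>Polygamma n z\<close> is the sum of the two.
\<close>

lemma obtain_good_abscissa:
  assumes "n > 0"
  obtains x where "x \<in> {0<..<1}" "Re (exp (2 * of_real pi * \<i> * of_real x) * - ((2 * of_real pi * \<i>) ^ Suc n)) > 0"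
    "\<And>y. polygamma_reflection n (Complex x y) \<noteq> 0"
proof -
  define U where "U = {0<..<1} \<inter> {x. Re (exp (2 * of_real pi * \<i> * of_real x) * - ((2 * of_real pi * \<i>) ^ Suc n)) > 0}"
  have "open U"
    unfolding U_def by (intro open_Int open_Collect_less continuous_intros open_greaterThanLessThan)
  moreover have "U \<noteq> {}"
    using exists_rotation_Re_pos[of "- ((2 * of_real pi * \<i>) ^ Suc n)"] by (auto simp: U_def)
  ultimately obtain x e where "e > 0" "ball x e \<subseteq> U"
    by (meson all_not_in_conv open_contains_ball)
  \<comment> \<open>The phase condition leaves a nonempty open set of abscissae, whereas the zeros
    have only countably many real parts, so both requirements can be met together.\<close>
  hence "uncountable U"
    using countable_subset uncountable_ball by blast
  define Z where "Z = Re ` {z \<in> -\<int>. polygamma_reflection n z = 0}"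
  have "countable Z"
    unfolding Z_def by (intro countable_image countable_zeros_polygamma_reflection assms)
  with \<open>uncountable U\<close> have "\<not> U \<subseteq> Z"
    using countable_subset by blast
  then obtain x where x: "x \<in> U" "x \<notin> Z"
    by blast
  show ?thesis
  proof (rule that[of x])
    fix y
    have "Complex x y \<notin> \<int>"
    proof
      assume "Complex x y \<in> \<int>"
      then obtain m :: int where "Complex x y = of_int m" by (auto elim: Ints_cases)
      hence "x = of_int m" by (simp add: complex_eq_iff)
      with x show False by (auto simp: U_def)
    qed
    with x(2) show "polygamma_reflection n (Complex x y) \<noteq> 0"
      unfolding Z_def by force
  qed (use x in \<open>auto simp: U_def\<close>)
qed

text \<open>Made for u = 1 - z with z on the left edge and |Im z| <= sqrt(2N): there Re u > N, hence
  |Im u| <= 2 sqrt(Re u).\<close>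

definition parabola_at_infinity :: "complex filter" where
  "parabola_at_infinity = inf (filtercomap Re at_top) (principal {z. \<bar>Im z\<bar> \<le> 2 * sqrt (Re z)})"

text \<open>Here Im u / Re u -> 0, so u^n is asymptotic to the positive number (Re u)^n, and
  (-1)^(n+1) \<open>Polygamma n u\<close> is almost real and positive. It therefore cannot cancel a
  second term whose real part is positive.\<close>

lemma Polygamma_parabola:
  assumes "n > 0" "\<delta> > 0"
  obtains B where "\<And>u. Re u \<ge> B \<Longrightarrow> \<bar>Im u\<bar> \<le> 2 * sqrt (Re u) \<Longrightarrow>
     Polygamma n u \<noteq> 0 \<and> norm (Polygamma n u) \<le> \<delta> \<and> norm (Polygamma (Suc n) u) \<le> norm (Polygamma n u) \<and>
     Re ((-1) ^ Suc n * Polygamma n u) \<ge> norm (Polygamma n u) / 2"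
proof -
  define G where "G = parabola_at_infinity"
  define V where "V = (\<lambda>u::complex. (-1) ^ Suc n * Polygamma n u)"
  have Re: "filterlim Re at_top G"
    unfolding G_def parabola_at_infinity_def by (rule filterlim_mono[OF filterlim_filtercomap]) auto
  have Re_pos: "eventually (\<lambda>u. Re u > 0) G"
    using Re by (simp add: filterlim_at_top_dense)
  have Im: "eventually (\<lambda>u. \<bar>Im u\<bar> \<le> 2 * sqrt (Re u)) G"
    unfolding G_def parabola_at_infinity_def eventually_inf_principal by simp
  have inf: "filterlim (\<lambda>u. u) at_infinity G"
    unfolding filterlim_at_infinity_conv_norm_at_top
    by (rule filterlim_at_top_mono[OF Re]) (simp add: complex_Re_le_cmod)
  have le: "G \<le> right_half_at_infinity"
    unfolding right_half_at_infinity_def le_inf_iff le_principal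
    using inf Re_pos by (auto simp: filterlim_def elim: eventually_mono)
  note lim = tendsto_mono[OF le tendsto_Polygamma_right_half]
  have "((\<lambda>u. of_real (Im u / Re u)) \<longlongrightarrow> (0 :: complex)) G"
  proof (rule Lim_null_comparison)
    have "((\<lambda>x. 2 / sqrt x) \<longlongrightarrow> 0) at_top" by real_asymp
    from filterlim_compose[OF this Re] show "((\<lambda>u. 2 / sqrt (Re u)) \<longlongrightarrow> 0) G" .
    show "\<forall>\<^sub>F u in G. norm (of_real (Im u / Re u) :: complex) \<le> 2 / sqrt (Re u)"
      using Re_pos Im
    proof eventually_elim
      case (elim u)
      have "\<bar>Im u\<bar> / Re u \<le> 2 * sqrt (Re u) / Re u"
        using elim by (intro divide_right_mono) auto
      also have "\<dots> = 2 / sqrt (Re u)"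
        using elim by (simp add: field_simps)
      finally show ?case using elim by (simp only: norm_of_real abs_divide abs_of_pos)
    qed
  qed
  hence "((\<lambda>u. 1 + \<i> * of_real (Im u / Re u)) \<longlongrightarrow> 1 + \<i> * 0) G"
    by (intro tendsto_intros)
  moreover have "eventually (\<lambda>u. 1 + \<i> * of_real (Im u / Re u) = u / of_real (Re u)) G"
    using Re_pos by eventually_elim (simp add: complex_eq_iff)
  ultimately have "((\<lambda>u. u / of_real (Re u)) \<longlongrightarrow> 1) G"
    by (subst (asm) tendsto_cong) auto
  hence "((\<lambda>u. (-1) ^ Suc n * (Polygamma n u * u ^ n) / (u / of_real (Re u)) ^ n) \<longlongrightarrow> 
            (-1) ^ Suc n * ((-1) ^ Suc n * fact (n - 1)) / 1 ^ n) G"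
    by (intro tendsto_divide tendsto_mult_left lim tendsto_power assms) (auto simp: power_one)
  moreover have "eventually (\<lambda>u. (-1) ^ Suc n * (Polygamma n u * u ^ n) / (u / of_real (Re u)) ^ n = 
                    V u * of_real (Re u ^ n)) G"
    using Re_pos by eventually_elim (auto simp: V_def power_divide field_simps)
  ultimately have "((\<lambda>u. V u * of_real (Re u ^ n)) \<longlongrightarrow> 
            (-1) ^ Suc n * ((-1) ^ Suc n * fact (n - 1)) / 1 ^ n) G"
    by (rule Lim_transform_eventually)
  hence V: "((\<lambda>u. V u * of_real (Re u ^ n)) \<longlongrightarrow> fact (n - 1)) G"
    by (cases "even n") simp_all
  \<comment> \<open>The limit is (n-1)! / 2 > 0; asking for only half of the norm is what leaves
    room for an eventual inequality.\<close>
  have "((\<lambda>u. Re (V u * of_real (Re u ^ n)) - norm (V u * of_real (Re u ^ n)) / 2) \<longlongrightarrow> 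
           Re (fact (n - 1)) - norm (fact (n - 1) :: complex) / 2) G"
    by (intro tendsto_intros V) simp
  hence "eventually (\<lambda>u. Re (V u * of_real (Re u ^ n)) - norm (V u * of_real (Re u ^ n)) / 2 > 0) G"
    by (rule order_tendstoD) (simp add: norm_fact)
  hence ReV: "eventually (\<lambda>u. Re (V u) \<ge> norm (Polygamma n u) / 2) G"
    using Re_pos
  proof eventually_elim
    case (elim u)
    have "Re (V u * of_real (Re u ^ n)) = Re (V u) * Re u ^ n"
      by (simp del: of_real_power)
    moreover have "norm (V u * of_real (Re u ^ n)) = norm (Polygamma n u) * Re u ^ n"
      using elim by (simp add: norm_mult norm_power V_def)
    ultimately have "(Re (V u) - norm (Polygamma n u) / 2) * Re u ^ n > 0"
      using elim by (simp add: algebra_simps)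
    thus ?case
      using elim by (simp add: zero_less_mult_iff)
  qed
  note * = quotient_tendsto_0_of_power_asymp[OF lim[OF assms(1)] _ lim inf]
  have "((\<lambda>u. Polygamma n u * u ^ n * inverse u ^ n) \<longlongrightarrow> (-1) ^ Suc n * fact (n - 1) * 0 ^ n) G"
    by (intro tendsto_mult tendsto_power lim assms filterlim_compose[OF tendsto_inverse_0 inf])
  moreover have "eventually (\<lambda>u. Polygamma n u * u ^ n * inverse u ^ n = Polygamma n u) G"
    using Re_pos by eventually_elim (auto simp: field_simps)
  ultimately have "(Polygamma n \<longlongrightarrow> 0) G"
    using assms by (subst (asm) tendsto_cong) (auto simp: zero_power)
  from order_tendstoD(2)[OF tendsto_norm_zero[OF this] assms(2)]
  have "eventually (\<lambda>u. norm (Polygamma n u) < \<delta>) G" .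
  moreover have "eventually (\<lambda>u. norm (Polygamma (Suc n) u / Polygamma n u) < 1) G"
    by (rule order_tendstoD(2)[OF tendsto_norm_zero[OF *(1)]]) auto
  moreover have "eventually (\<lambda>u. Polygamma n u \<noteq> 0) G"
    by (rule *(2)) auto
  ultimately have "eventually (\<lambda>u. Polygamma n u \<noteq> 0 \<and> norm (Polygamma n u) \<le> \<delta> \<and> norm (Polygamma (Suc n) u) \<le> norm (Polygamma n u) \<and>
     Re ((-1) ^ Suc n * Polygamma n u) \<ge> norm (Polygamma n u) / 2) G"
    using ReV by eventually_elim (auto simp: V_def norm_divide divide_less_eq)
  then obtain P where P: "eventually P at_top"
    "\<And>u. P (Re u) \<Longrightarrow> \<bar>Im u\<bar> \<le> 2 * sqrt (Re u) \<Longrightarrow> 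
     Polygamma n u \<noteq> 0 \<and> norm (Polygamma n u) \<le> \<delta> \<and> norm (Polygamma (Suc n) u) \<le> norm (Polygamma n u) \<and>
     Re ((-1) ^ Suc n * Polygamma n u) \<ge> norm (Polygamma n u) / 2"
    unfolding G_def parabola_at_infinity_def eventually_inf_principal eventually_filtercomap mem_Collect_eq
    by blast
  from P(1) obtain B where B: "\<And>x. x \<ge> B \<Longrightarrow> P x"
    by (auto simp: eventually_at_top_linorder)
  show ?thesis
  proof (rule that[of B])
    fix u :: complex
    assume "Re u \<ge> B" "\<bar>Im u\<bar> \<le> 2 * sqrt (Re u)"
    thus "Polygamma n u \<noteq> 0 \<and> norm (Polygamma n u) \<le> \<delta> \<and> norm (Polygamma (Suc n) u) \<le> norm (Polygamma n u) \<and>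
       Re ((-1) ^ Suc n * Polygamma n u) \<ge> norm (Polygamma n u) / 2"
      by (intro P(2) B)
  qed
qed

text \<open>By the reflection formula \<open>Polygamma n z\<close> is -(a + V), where a has size
  exp(-2 pi y) and V, coming from 1 - z, has size N^(-n). They balance at heights of order log N,
  where only the phase of a prevents cancellation: both real parts are then a fixed fraction of the
  moduli. On the remaining compact range of heights, a is bounded away from 0 and V is small. So |a
  + V| is comparable to |a| + |V| throughout.\<close>

lemma Polygamma_ratio_bounded_left:
  assumes n: "n > 0" and x: "x \<in> {0<..<1}"
    and pos: "Re (exp (2 * of_real pi * \<i> * of_real x) * - ((2 * of_real pi * \<i>) ^ Suc n)) > 0"
    and nz: "\<And>y. polygamma_reflection n (Complex x y) \<noteq> 0"
  obtains M N0 where "M > 0"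
    "\<And>N y. N \<ge> N0 \<Longrightarrow> \<bar>y\<bar> \<le> sqrt (2 * real N) \<Longrightarrow>
       Polygamma n (Complex (x - real N) y) \<noteq> 0 \<and>
       norm (Polygamma (Suc n) (Complex (x - real N) y) / Polygamma n (Complex (x - real N) y)) \<le> M"
proof -
  define a where "a = (\<lambda>y. polygamma_reflection n (Complex x y))"
  define b where "b = (\<lambda>y. polygamma_reflection (Suc n) (Complex x y))"
  define c where "c = (\<lambda>n. - ((2 * of_real pi * \<i>) ^ Suc n) :: complex)"
  define E where "E = (\<lambda>y. exp (2 * of_real pi * \<i> * Complex x y))"
  \<comment> \<open>On this line the exponential is W times a positive number, so the direction of a
    y converges as y grows.\<close>
  define W where "W = exp (2 * of_real pi * \<i> * of_real x)"
  have E: "E y = W * of_real (exp (-(2 * pi * y)))" for y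
  proof -
    have "2 * of_real pi * \<i> * Complex x y = 2 * of_real pi * \<i> * of_real x + of_real (-(2 * pi * y))"
      by (simp add: complex_eq_iff)
    thus ?thesis unfolding E_def W_def by (simp only: exp_add exp_of_real)
  qed
  have notin: "Complex t y \<notin> \<int>" if "t - x \<in> \<int>" for t y
  proof
    assume "Complex t y \<in> \<int>"
    hence "t \<in> \<int>" by (auto simp: complex_is_Int_iff)
    hence "t - (t - x) \<in> \<int>" using that by (rule Ints_diff)
    then obtain m :: int where "x = of_int m" by (auto elim: Ints_cases)
    with x show False by auto
  qed
  have "filterlim (\<lambda>y. Complex x y) (filtercomap Im at_top) at_top"
    by (simp add: filterlim_filtercomap_iff o_def filterlim_ident)
  note lim = filterlim_compose[OF tendsto_polygamma_reflection_upper this]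
  have lim_a: "((\<lambda>y. a y / E y) \<longlongrightarrow> c n) at_top" and lim_b: "((\<lambda>y. b y / E y) \<longlongrightarrow> c (Suc n)) at_top"
    unfolding a_def b_def c_def E_def by (rule lim; use n in simp)+
  have lim_a': "((\<lambda>y. a y * of_real (exp (2 * pi * y))) \<longlongrightarrow> W * c n) at_top"
  proof (rule Lim_transform_eventually[OF tendsto_mult_left[OF lim_a, of W]])
    show "\<forall>\<^sub>F y in at_top. W * (a y / E y) = a y * of_real (exp (2 * pi * y))"
      by (simp add: E W_def exp_minus field_simps flip: exp_of_real)
  qed
  have pos': "Re (W * c n) > 0"
    using pos unfolding W_def c_def .
  \<comment> \<open>Half the cosine of the argument of the limit; the half is the slack for an
    eventual lower bound of \<open>Re (a y)\<close> by \<open>\<kappa> * norm (a y)\<close>.\<close>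
  define \<kappa> where "\<kappa> = Re (W * c n) / (2 * norm (W * c n))"
  have \<kappa>: "\<kappa> > 0" "\<kappa> \<le> 1"
  proof -
    show "\<kappa> > 0" using pos' unfolding \<kappa>_def by (auto intro!: divide_pos_pos)
    show "\<kappa> \<le> 1" using complex_Re_le_cmod[of "W * c n"] pos' unfolding \<kappa>_def
      by (auto simp: divide_le_eq)
  qed
  have "((\<lambda>y. Re (a y * of_real (exp (2 * pi * y))) - \<kappa> * norm (a y * of_real (exp (2 * pi * y)))) \<longlongrightarrow>
           Re (W * c n) - \<kappa> * norm (W * c n)) at_top"
    by (intro tendsto_intros lim_a')
  moreover have "Re (W * c n) - \<kappa> * norm (W * c n) > 0"
  proof -
    have "norm (W * c n) \<noteq> 0" using pos' by auto
    hence "\<kappa> * norm (W * c n) = Re (W * c n) / 2" unfolding \<kappa>_def by simp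
    thus ?thesis using pos' by linarith
  qed
  ultimately have "eventually (\<lambda>y. Re (a y * of_real (exp (2 * pi * y))) - \<kappa> * norm (a y * of_real (exp (2 * pi * y))) > 0) at_top"
    by (rule order_tendstoD)
  hence ev1: "eventually (\<lambda>y. Re (a y) \<ge> \<kappa> * norm (a y)) at_top"
  proof eventually_elim
    case (elim y)
    have "(Re (a y) - \<kappa> * norm (a y)) * exp (2 * pi * y) > 0"
      using elim by (simp add: norm_mult algebra_simps)
    thus ?case by (simp add: zero_less_mult_iff)
  qed
  have "((\<lambda>y. (b y / E y) / (a y / E y)) \<longlongrightarrow> c (Suc n) / c n) at_top"
    by (intro tendsto_divide lim_a lim_b) (auto simp: c_def)
  hence "((\<lambda>y. b y / a y) \<longlongrightarrow> c (Suc n) / c n) at_top"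
    by (simp add: E_def)
  from order_tendstoD(2)[OF tendsto_norm[OF this], of "norm (c (Suc n) / c n) + 1"]
  have "eventually (\<lambda>y. norm (b y / a y) < norm (c (Suc n) / c n) + 1) at_top" by simp
  with ev1 have "eventually (\<lambda>y. Re (a y) \<ge> \<kappa> * norm (a y) \<and> norm (b y / a y) < norm (c (Suc n) / c n) + 1) at_top"
    by (rule eventually_conj)
  then obtain Y where Y: "\<And>y. y \<ge> Y \<Longrightarrow> Re (a y) \<ge> \<kappa> * norm (a y)"
      "\<And>y. y \<ge> Y \<Longrightarrow> norm (b y / a y) < norm (c (Suc n) / c n) + 1"
    by (auto simp: eventually_at_top_linorder)
  have cont: "continuous_on {0..Y} (\<lambda>y. polygamma_reflection m (Complex x y))" for m
  proof (rule continuous_on_compose2[where g = "polygamma_reflection m" and t = "-\<int>"])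
    show "continuous_on (-\<int>) (polygamma_reflection m)"
      using DERIV_isCont[OF has_field_derivative_polygamma_reflection]
      by (intro continuous_at_imp_continuous_on) auto
    show "continuous_on {0..Y} (Complex x)"
      unfolding Complex_eq by (intro continuous_intros)
  qed (use notin in auto)
  have nz_a: "a y \<noteq> 0" for y by (simp add: a_def nz)
  have "bounded ((\<lambda>y. b y / a y) ` {0..Y})"
    using cont nz_a unfolding a_def b_def
    by (intro compact_imp_bounded compact_continuous_image continuous_intros) auto
  then obtain M1' where "\<forall>w\<in>(\<lambda>y. b y / a y) ` {0..Y}. norm w \<le> M1'"
    unfolding bounded_iff by blast
  hence M1': "norm (b y / a y) \<le> M1'" if "y \<in> {0..Y}" for y
    using that by blast
  have "bounded ((\<lambda>y. 1 / a y) ` {0..Y})"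
    using cont nz_a unfolding a_def b_def
    by (intro compact_imp_bounded compact_continuous_image continuous_intros) auto
  then obtain s where "s > 0" "\<forall>w\<in>(\<lambda>y. 1 / a y) ` {0..Y}. norm w \<le> s"
    unfolding bounded_pos by blast
  hence s: "s > 0" "\<And>y. y \<in> {0..Y} \<Longrightarrow> norm (1 / a y) \<le> s"
    by blast+
  define M1 where "M1 = max 0 (max M1' (norm (c (Suc n) / c n) + 1))"
  have M1: "norm (b y) \<le> M1 * norm (a y)" if "y \<ge> 0" for y
  proof -
    have "norm (b y / a y) \<le> M1"
      using M1'[of y] Y(2)[of y] that unfolding M1_def by (cases "y \<le> Y") auto
    thus ?thesis using nz_a by (simp add: norm_divide field_simps)
  qed
  have M1_nonneg: "M1 \<ge> 0" by (simp add: M1_def)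
  \<comment> \<open>1/s is a lower bound for |a| on the heights from 0 to Y, so the choice 1 / (2 s)
    forces |V| <= |a| / 2 there.\<close>
  obtain B where B: "\<And>u::complex. Re u \<ge> B \<Longrightarrow> \<bar>Im u\<bar> \<le> 2 * sqrt (Re u) \<Longrightarrow>
     Polygamma n u \<noteq> 0 \<and> norm (Polygamma n u) \<le> 1 / (2 * s) \<and> norm (Polygamma (Suc n) u) \<le> norm (Polygamma n u) \<and>
     Re ((-1) ^ Suc n * Polygamma n u) \<ge> norm (Polygamma n u) / 2"
    using Polygamma_parabola[OF n, of "1 / (2 * s)"] s by auto
  \<comment> \<open>Quotient of the two bounds to come: numerator at most (M1 + 1)(|a| + |V|),
    denominator at least \<open>\<kappa> / 4\<close> times |a| + |V|.\<close>
  define M where "M = 4 * (M1 + 1) / \<kappa>"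
  have upper: "Polygamma n (Complex (x - real N) y) \<noteq> 0 \<and>
       norm (Polygamma (Suc n) (Complex (x - real N) y) / Polygamma n (Complex (x - real N) y)) \<le> M"
    if "real N \<ge> B" "y \<ge> 0" "y \<le> sqrt (2 * real N)" for N y
  proof -
    define z where "z = Complex (x - real N) y"
    define V where "V = (-1) ^ Suc n * Polygamma n (1 - z)"
    have "\<bar>Im (1 - z)\<bar> \<le> sqrt (2 * real N)"
      using that by (simp add: z_def)
    also have "\<dots> \<le> sqrt (4 * Re (1 - z))"
      using x by (intro real_sqrt_le_mono) (simp add: z_def)
    also have "\<dots> = 2 * sqrt (Re (1 - z))"
      by (simp only: real_sqrt_mult real_sqrt_four)
    finally have "\<bar>Im (1 - z)\<bar> \<le> 2 * sqrt (Re (1 - z))" .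
    from B[OF _ this] x that have V: "V \<noteq> 0" "norm V \<le> 1 / (2 * s)" 
        "norm (Polygamma (Suc n) (1 - z)) \<le> norm V" "Re V \<ge> norm V / 2"
      by (auto simp: z_def V_def norm_mult norm_power)
    have z_eq: "z = Complex x y - of_nat N"
      by (simp add: z_def complex_eq_iff)
    have "polygamma_reflection n z = a y" "polygamma_reflection (Suc n) z = b y"
      unfolding z_eq a_def b_def by (intro polygamma_reflection_minus_of_nat notin; simp)+
    hence P: "Polygamma n z = -(a y + V)" "Polygamma (Suc n) z = (-1) ^ Suc n * Polygamma (Suc n) (1 - z) - b y"
      by (simp_all add: polygamma_reflection_def V_def algebra_simps)
    have lower: "norm (a y + V) \<ge> \<kappa> / 4 * (norm (a y) + norm V)"
    proof (cases "y \<ge> Y")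
      case True
      have "\<kappa> / 4 * (norm (a y) + norm V) = \<kappa> / 4 * norm (a y) + \<kappa> / 4 * norm V"
        by (simp add: algebra_simps)
      also have "\<dots> \<le> \<kappa> * norm (a y) + 1 / 2 * norm V"
        using \<kappa> by (intro add_mono mult_right_mono) auto
      also have "\<dots> \<le> Re (a y) + Re V"
        using V(4) Y(1)[OF True] by simp
      also have "\<dots> \<le> norm (a y + V)"
        using complex_Re_le_cmod[of "a y + V"] by simp
      finally show ?thesis .
    next
      case False
      hence "norm (1 / a y) \<le> s" using s that by auto
      hence "1 / (2 * s) \<le> norm (a y) / 2"
        using s(1) nz_a[of y] by (simp add: norm_divide field_simps)
      with V(2) have *: "norm V \<le> norm (a y) / 2" by linarith
      have "\<kappa> / 4 * (norm (a y) + norm V) \<le> 1 / 4 * (norm (a y) + norm V)"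
        using \<kappa> by (intro mult_right_mono) auto
      also have "\<dots> \<le> norm (a y) - norm V"
      proof -
        have "5 * norm V \<le> 3 * norm (a y)"
          using add_mono[OF * norm_ge_zero[of "a y"]] norm_ge_zero[of "a y"] * by linarith
        thus ?thesis by (simp add: field_simps)
      qed
      also have "\<dots> \<le> norm (a y + V)"
        using norm_triangle_ineq2[of "a y" "-V"] by simp
      finally show ?thesis .
    qed
    have "0 < \<kappa> / 4 * (norm (a y) + norm V)"
      using \<kappa> V(1) by (intro mult_pos_pos add_nonneg_pos) auto
    with lower have "norm (a y + V) > 0" by linarith
    hence nz: "Polygamma n z \<noteq> 0" using P by auto
    have "norm (Polygamma (Suc n) z) \<le> norm (Polygamma (Suc n) (1 - z)) + norm (b y)"
      unfolding P using norm_triangle_ineq4[of "(-1) ^ Suc n * Polygamma (Suc n) (1 - z)" "b y"]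
      by (simp add: norm_mult norm_power)
    also have "\<dots> \<le> norm V + M1 * norm (a y)"
      using V M1[OF that(2)] by linarith
    also have "\<dots> \<le> (M1 + 1) * (norm (a y) + norm V)"
      using M1_nonneg by (simp add: algebra_simps)
    also have "\<dots> = M * (\<kappa> / 4 * (norm (a y) + norm V))"
      using \<kappa> by (simp add: M_def)
    also have "\<dots> \<le> M * norm (Polygamma n z)"
      using lower M1_nonneg \<kappa> unfolding P(1) norm_minus_cancel
      by (intro mult_left_mono) (auto simp: M_def)
    finally show ?thesis
      using nz unfolding z_def by (simp add: norm_divide divide_le_eq)
  qed
  have "M > 0"
    using M1_nonneg \<kappa> by (simp add: M_def)
  thus ?thesis
  proof (rule that[of M "nat \<lceil>B\<rceil>"])
    fix N :: nat and y :: real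
    assume N: "N \<ge> nat \<lceil>B\<rceil>" and y: "\<bar>y\<bar> \<le> sqrt (2 * real N)"
    have N': "real N \<ge> B" using N by linarith
    show "Polygamma n (Complex (x - real N) y) \<noteq> 0 \<and>
       norm (Polygamma (Suc n) (Complex (x - real N) y) / Polygamma n (Complex (x - real N) y)) \<le> M"
    proof (cases "y \<ge> 0")
      case True
      thus ?thesis using upper[OF N'] y by simp
    next
      case False
      define z where "z = Complex (x - real N) (-y)"
      have "Complex (x - real N) y = cnj z" by (simp add: z_def complex_eq_iff)
      moreover have "z \<noteq> 0" using False by (auto simp: z_def complex_eq_iff)
      ultimately show ?thesis
        using upper[OF N', of "-y"] False y n unfolding z_def[symmetric]
        by (simp add: Polygamma_cnj flip: complex_cnj_divide)
    qed
  qed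
qed

section \<open>Zeros, poles and residues\<close>

abbreviation polygamma_sing :: "nat \<Rightarrow> complex set" where
  "polygamma_sing n \<equiv> polygamma_zeros n \<union> \<int>\<^sub>\<le>\<^sub>0"

lemma nonpos_Ints_complex_cases:
  assumes "p \<in> (\<int>\<^sub>\<le>\<^sub>0 :: complex set)"
  obtains m where "p = - of_nat m"
  using assms by (auto elim: nonpos_Ints_cases')

lemma nonpos_Ints_isolated:
  assumes "z \<in> ball (- of_nat m) 1 - {- of_nat m}"
  shows "z \<notin> (\<int>\<^sub>\<le>\<^sub>0 :: complex set)"
proof
  assume "z \<in> \<int>\<^sub>\<le>\<^sub>0"
  then obtain k where k: "z = - of_nat k" by (rule nonpos_Ints_complex_cases)
  have "- of_nat m - z = of_int (int k - int m)"
    by (simp add: k)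
  hence "dist (- of_nat m) z = of_int \<bar>int k - int m\<bar>"
    by (simp only: dist_norm norm_of_int of_int_abs)
  moreover have "dist (- of_nat m) z < 1"
    using assms by simp
  ultimately have "\<bar>int k - int m\<bar> < 1"
    by (simp only: of_int_less_1_iff)
  hence "k = m" by simp
  thus False using assms by (simp add: k)
qed

text \<open>Shifting by m + 1 moves the unit ball around -m to the right of all poles. Of the m + 1
  terms that the recurrence produces, only the last is singular at -m; h collects the rest. The
  equation is confined to the punctured ball because \<open>Polygamma\<close> has a conventional
  value at the pole.\<close>

lemma Polygamma_near_pole:
  fixes m n :: nat
  obtains g where "g holomorphic_on ball (- of_nat m) 1" "g (- of_nat m) = (-1) ^ Suc n * fact n"
    "\<And>z. z \<in> ball (- of_nat m) 1 - {- of_nat m} \<Longrightarrow> Polygamma n z = g z / (z - (- of_nat m)) ^ Suc n"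
proof -
  define p :: complex where "p = - of_nat m"
  define h where "h = (\<lambda>z. Polygamma n (z + of_nat (Suc m)) - (-1) ^ n * fact n * (\<Sum>k<m. 1 / (z + of_nat k) ^ Suc n) :: complex)"
  have Re: "Re z > - real m - 1" "Re z < - real m + 1" if "z \<in> ball p 1" for z
  proof -
    have "\<bar>Re (z - p)\<bar> < 1"
      using that abs_Re_le_cmod[of "z - p"] by (simp add: dist_norm norm_minus_commute)
    thus "Re z > - real m - 1" "Re z < - real m + 1" by (simp_all add: p_def)
  qed
  have nz: "z + of_nat k \<noteq> 0" if "z \<in> ball p 1" "k < m" for z k
  proof
    assume "z + of_nat k = 0"
    hence "Re (z + of_nat k) = 0" by simp
    with Re[OF that(1)] that(2) show False by simp
  qed
  have notin: "z + of_nat (Suc m) \<notin> \<int>\<^sub>\<le>\<^sub>0" if "z \<in> ball p 1" for z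
    using Re[OF that] by (auto elim!: nonpos_Ints_complex_cases simp: complex_eq_iff)
  have holo: "h holomorphic_on ball p 1"
  proof -
    have "(\<lambda>z. Polygamma n (z + of_nat (Suc m))) holomorphic_on ball p 1"
      using notin by (intro analytic_imp_holomorphic analytic_on_Polygamma' analytic_intros) auto
    thus ?thesis
      unfolding h_def using nz by (auto intro!: holomorphic_intros)
  qed
  show ?thesis
  proof (rule that[of "\<lambda>z. h z * (z - p) ^ Suc n + (-1) ^ Suc n * fact n", folded p_def])
    show "(\<lambda>z. h z * (z - p) ^ Suc n + (-1) ^ Suc n * fact n) holomorphic_on ball p 1"
      by (intro holomorphic_intros holo)
    fix z assume z: "z \<in> ball p 1 - {p}"
    have *: "\<forall>k<Suc m. z \<noteq> - of_nat k"
    proof safe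
      fix k assume k: "k < Suc m" "z = - of_nat k"
      hence "k \<noteq> m" using z unfolding p_def by blast
      hence "z + of_nat k \<noteq> 0" using k z by (intro nz) auto
      thus False using k(2) by simp
    qed
    have "z + of_nat m = z - p" by (simp add: p_def)
    have "z - p \<noteq> 0" using z by simp
    have eq: "Polygamma n (z + of_nat (Suc m)) = 
        Polygamma n z + (-1) ^ n * fact n * ((\<Sum>k<m. 1 / (z + of_nat k) ^ Suc n) + 1 / (z - p) ^ Suc n)"
      using Polygamma_plus_of_nat[OF *, of n] unfolding sum.lessThan_Suc \<open>z + of_nat m = z - p\<close> .
    have "Polygamma n z = h z - (-1) ^ n * fact n / (z - p) ^ Suc n"
      unfolding h_def eq by (simp add: ring_distribs del: power_Suc of_nat_Suc)
    also have "\<dots> = (h z * (z - p) ^ Suc n + (-1) ^ Suc n * fact n) / (z - p) ^ Suc n"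
      using \<open>z - p \<noteq> 0\<close> by (simp add: add_divide_distrib diff_divide_distrib)
    finally show "Polygamma n z = (h z * (z - p) ^ Suc n + (-1) ^ Suc n * fact n) / (z - p) ^ Suc n" .
  qed simp
qed

lemma connected_open_Compl_nonpos_Ints: "connected (-\<int>\<^sub>\<le>\<^sub>0 :: complex set)" "open (-\<int>\<^sub>\<le>\<^sub>0 :: complex set)"
proof -
  have "countable (\<int>\<^sub>\<le>\<^sub>0 :: complex set)"
    by (rule countable_subset[of _ \<int>]) (auto simp: nonpos_Ints_Int Ints_def)
  from connected_open_diff_countable[OF _ open_UNIV connected_UNIV this]
  show "connected (-\<int>\<^sub>\<le>\<^sub>0 :: complex set)"
    by (simp add: Compl_eq_Diff_UNIV)
  show "open (-\<int>\<^sub>\<le>\<^sub>0 :: complex set)"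
    by (simp add: open_Compl)
qed

lemma Polygamma_nonzero_point:
  assumes "n > 0"
  obtains z :: complex where "z \<notin> \<int>\<^sub>\<le>\<^sub>0" "Polygamma n z \<noteq> 0"
proof -
  obtain R where R: "R > 0" "\<And>z::complex. norm z \<ge> R \<Longrightarrow> Re z \<ge> 0 \<or> \<bar>Im z\<bar> \<ge> sqrt (norm z) \<Longrightarrow> 
       Polygamma n z \<noteq> 0 \<and> norm (Polygamma (Suc n) z / Polygamma n z) \<le> 1"
    by (rule Polygamma_ratio_small[OF assms zero_less_one]) blast
  show ?thesis
  proof (rule that)
    show "complex_of_real R \<notin> \<int>\<^sub>\<le>\<^sub>0"
      using R(1) by (auto elim!: nonpos_Ints_complex_cases simp: complex_eq_iff)
    show "Polygamma n (complex_of_real R) \<noteq> 0"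
      using R by simp
  qed
qed

lemma Polygamma_near_zero:
  assumes "n > 0" "p \<in> polygamma_zeros n"
  obtains g r where "r > 0" "ball p r \<subseteq> -\<int>\<^sub>\<le>\<^sub>0" "g holomorphic_on ball p r" "\<And>z. z \<in> ball p r \<Longrightarrow> g z \<noteq> 0"
    "\<And>z. z \<in> ball p r \<Longrightarrow> Polygamma n z = g z * (z - p) ^ nat (polygamma_zero_order n p)"
    "polygamma_zero_order n p > 0"
proof -
  have p: "p \<in> -\<int>\<^sub>\<le>\<^sub>0" "Polygamma n p = 0"
    using assms(2) by (auto simp: polygamma_zeros_def)
  have "Polygamma n holomorphic_on -\<int>\<^sub>\<le>\<^sub>0"
    by (rule holomorphic_on_Polygamma) auto
  moreover have "\<exists>w\<in>-\<int>\<^sub>\<le>\<^sub>0. Polygamma n w \<noteq> (0::complex)"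
    using Polygamma_nonzero_point[OF assms(1)] by blast
  ultimately have *: "(if Polygamma n p = 0 then zorder (Polygamma n) p > 0 else zorder (Polygamma n) p = 0) \<and>
      (\<exists>r. r > 0 \<and> cball p r \<subseteq> -\<int>\<^sub>\<le>\<^sub>0 \<and> zor_poly (Polygamma n) p holomorphic_on cball p r
    \<and> (\<forall>w\<in>cball p r. Polygamma n w = zor_poly (Polygamma n) p w * (w - p) ^ nat (zorder (Polygamma n) p) \<and> zor_poly (Polygamma n) p w \<noteq>0))"
    using p connected_open_Compl_nonpos_Ints by (intro zorder_exist_zero) auto
  then obtain r where r: "r > 0" "cball p r \<subseteq> -\<int>\<^sub>\<le>\<^sub>0" "zor_poly (Polygamma n) p holomorphic_on cball p r"
    "\<And>w. w\<in>cball p r \<Longrightarrow> Polygamma n w = zor_poly (Polygamma n) p w * (w - p) ^ nat (zorder (Polygamma n) p) \<and> zor_poly (Polygamma n) p w \<noteq>0"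
    by blast
  show ?thesis
  proof (rule that)
    show "ball p r \<subseteq> -\<int>\<^sub>\<le>\<^sub>0" using r(2) ball_subset_cball by blast
    show "zor_poly (Polygamma n) p holomorphic_on ball p r"
      using r(3) ball_subset_cball by (rule holomorphic_on_subset)
    show "polygamma_zero_order n p > 0"
      using * p(2) by (simp only: polygamma_zero_order_def if_True simp_thms)
    fix z assume "z \<in> ball p r"
    hence "z \<in> cball p r" by simp
    from r(4)[OF this] show "zor_poly (Polygamma n) p z \<noteq> 0"
      "Polygamma n z = zor_poly (Polygamma n) p z * (z - p) ^ nat (polygamma_zero_order n p)"
      by (simp_all only: polygamma_zero_order_def simp_thms)
  qed (rule r(1))
qed

text \<open>Zeros must not accumulate at the poles either. The identity theorem on the complement of
  the poles does not exclude this; the local form near a pole does.\<close>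

lemma finite_polygamma_sing:
  assumes "n > 0"
  shows "finite (cball 0 R \<inter> polygamma_sing n)"
proof (rule finite_not_islimpt_in_compact)
  fix p :: complex
  consider m where "p = - of_nat m" | "p \<in> -\<int>\<^sub>\<le>\<^sub>0" "Polygamma n p = 0" | "p \<in> -\<int>\<^sub>\<le>\<^sub>0" "Polygamma n p \<noteq> 0"
    using nonpos_Ints_complex_cases by blast
  hence "eventually (\<lambda>z. Polygamma n z \<noteq> 0) (at p)"
  proof cases
    case 1
    obtain g where g: "g holomorphic_on ball p 1" "g p = (-1) ^ Suc n * fact n"
      "\<And>z. z \<in> ball p 1 - {p} \<Longrightarrow> Polygamma n z = g z / (z - p) ^ Suc n"
      unfolding 1 using Polygamma_near_pole[of m n] by blast
    have "isCont g p"
      using g(1) by (intro continuous_on_interior[OF holomorphic_on_imp_continuous_on]) auto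
    moreover have "g p \<noteq> 0"
      unfolding g(2) by simp
    ultimately have "eventually (\<lambda>z. g z \<noteq> 0) (at p)"
      using tendsto_imp_eventually_ne[of g "g p" "at p" 0] by (simp only: isCont_def simp_thms)
    moreover have "eventually (\<lambda>z. z \<in> ball p 1 - {p}) (at p)"
      by (rule eventually_at_in_open) auto
    ultimately show ?thesis
    proof eventually_elim
      case (elim z)
      thus ?case unfolding g(3)[OF elim(2)] by simp
    qed
  next
    case 2
    hence "p \<in> polygamma_zeros n" by (auto simp: polygamma_zeros_def)
    from assms this obtain g r where g: "r > 0" "ball p r \<subseteq> -\<int>\<^sub>\<le>\<^sub>0" "g holomorphic_on ball p r"
      "\<And>z. z \<in> ball p r \<Longrightarrow> g z \<noteq> 0"
      "\<And>z. z \<in> ball p r \<Longrightarrow> Polygamma n z = g z * (z - p) ^ nat (polygamma_zero_order n p)"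
      "polygamma_zero_order n p > 0"
      by (rule Polygamma_near_zero) (rule that; assumption)
    have "eventually (\<lambda>z. z \<in> ball p r - {p}) (at p)"
      by (rule eventually_at_in_open) (use g in auto)
    thus ?thesis
    proof eventually_elim
      case (elim z)
      hence "z \<in> ball p r" by simp
      from g(4,5)[OF this] elim show ?case by simp
    qed
  next
    case 3
    have "isCont (Polygamma n) p"
      using 3 by (intro continuous_intros) auto
    thus ?thesis
      unfolding isCont_def by (rule tendsto_imp_eventually_ne) (use 3 in auto)
  qed
  moreover have "eventually (\<lambda>z. z \<notin> \<int>\<^sub>\<le>\<^sub>0) (at p)"
  proof (cases "p \<in> \<int>\<^sub>\<le>\<^sub>0")
    case True
    then obtain m where m: "p = - of_nat m" by (rule nonpos_Ints_complex_cases)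
    have "eventually (\<lambda>z. z \<in> ball p 1 - {p}) (at p)"
      by (rule eventually_at_in_open) auto
    thus ?thesis
      unfolding m by eventually_elim (rule nonpos_Ints_isolated)
  next
    case False
    have "eventually (\<lambda>z. z \<in> -\<int>\<^sub>\<le>\<^sub>0 - {p}) (at p)"
      by (rule eventually_at_in_open) (use False connected_open_Compl_nonpos_Ints in auto)
    thus ?thesis
      by eventually_elim auto
  qed
  ultimately have "eventually (\<lambda>z. z \<notin> polygamma_sing n) (at p)"
    by eventually_elim (auto simp: polygamma_zeros_def)
  thus "\<not> p islimpt polygamma_sing n"
    by (simp add: islimpt_iff_eventually)
qed auto

text \<open>From f'/f = g'/g + k/(z - p). The integer exponent treats zeros (k > 0) and poles (k <
  0) alike, and the factorisation is asked for off p only, so the value of f at a pole does not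
  matter.\<close>

lemma residue_logderiv:
  assumes "open S" "p \<in> S" "g holomorphic_on S" "h holomorphic_on S" "\<And>z. z \<in> S \<Longrightarrow> g z \<noteq> 0"
    and f: "\<And>z. z \<in> S - {p} \<Longrightarrow> f z = g z * (z - p) powi k"
  shows "residue (\<lambda>z. deriv f z / f z * h z) p = of_int k * h p"
proof -
  have "open (S - {p})" using assms(1) by auto
  have df: "deriv f z / f z = deriv g z / g z + of_int k / (z - p)" if z: "z \<in> S - {p}" for z
  proof -
    have zp: "z - p \<noteq> 0" using z by auto
    have "(g has_field_derivative deriv g z) (at z)"
      using assms(1,3) z by (intro holomorphic_derivI[of g S]) auto
    hence "((\<lambda>z. g z * (z - p) powi k) has_field_derivative 
             (g z * (of_int k * (z - p) powi (k - 1)) + deriv g z * (z - p) powi k)) (at z)"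
      using zp by (auto intro!: derivative_eq_intros)
    hence "(f has_field_derivative (g z * (of_int k * (z - p) powi (k - 1)) + deriv g z * (z - p) powi k)) (at z)"
      by (rule has_field_derivative_transform_within_open[OF _ \<open>open (S - {p})\<close> z]) (use f in auto)
    hence "deriv f z = g z * (of_int k * (z - p) powi (k - 1)) + deriv g z * (z - p) powi k"
      by (rule DERIV_imp_deriv)
    also have "(z - p) powi (k - 1) = (z - p) powi k / (z - p)"
      using zp by (simp add: power_int_diff)
    finally have "deriv f z / f z = (g z * (of_int k * ((z - p) powi k / (z - p))) + deriv g z * (z - p) powi k) / (g z * (z - p) powi k)"
      using f[OF z] by simp
    also have "\<dots> = deriv g z / g z + of_int k / (z - p)"
    proof -
      define W where "W = (z - p) powi k"
      have "W \<noteq> 0" "g z \<noteq> 0" using zp z assms(5) by (auto simp: W_def)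
      thus ?thesis unfolding W_def[symmetric] using zp by (simp add: field_simps)
    qed
    finally show ?thesis .
  qed
  \<comment> \<open>With the factor z - p taken out, the function becomes F / (z - p) with F
    holomorphic, and its residue is F p.\<close>
  define F where "F = (\<lambda>z. deriv g z / g z * (z - p) * h z + of_int k * h z)"
  have "residue (\<lambda>z. deriv f z / f z * h z) p = residue (\<lambda>z. F z / (z - p)) p"
  proof (rule residue_cong)
    have "eventually (\<lambda>z. z \<in> S - {p}) (at p)"
      by (rule eventually_at_in_open) (use assms in auto)
    thus "eventually (\<lambda>z. deriv f z / f z * h z = F z / (z - p)) (at p)"
    proof eventually_elim
      case (elim z)
      hence "z - p \<noteq> 0" by auto
      thus ?case unfolding df[OF elim] F_def by (simp add: field_simps)
    qed
  qed auto
  also have "\<dots> = F p"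
    unfolding F_def using assms by (intro residue_simple holomorphic_intros) auto
  finally show ?thesis by (simp add: F_def)
qed

definition polygamma_integrand :: "nat \<Rightarrow> nat \<Rightarrow> complex \<Rightarrow> complex" where
  "polygamma_integrand n j z = Polygamma (Suc n) z / Polygamma n z / z ^ j"

lemma residue_polygamma_integrand:
  assumes "open S" "p \<in> S" "p \<noteq> 0" "g holomorphic_on S" "\<And>z. z \<in> S \<Longrightarrow> g z \<noteq> 0"
    "\<And>z. z \<in> S - {p} \<Longrightarrow> z \<notin> \<int>\<^sub>\<le>\<^sub>0"
    "\<And>z. z \<in> S - {p} \<Longrightarrow> Polygamma n z = g z * (z - p) powi k"
  shows "residue (polygamma_integrand n j) p = of_int k / p ^ j"
proof -
  have "residue (\<lambda>z. deriv (Polygamma n) z / Polygamma n z * (1 / z ^ j)) p = of_int k * (1 / p ^ j)"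
  \<comment> \<open>0 is taken out because 1 / z^j is singular there; p remains since p is
    nonzero.\<close>
  proof (rule residue_logderiv[where S = "S - {0}"])
    show "open (S - {0})" using assms by auto
    show "g holomorphic_on S - {0}" using assms(4) by (rule holomorphic_on_subset) auto
    show "(\<lambda>z. 1 / z ^ j) holomorphic_on S - {0}" by (intro holomorphic_intros) auto
  qed (use assms in auto)
  also have "residue (\<lambda>z. deriv (Polygamma n) z / Polygamma n z * (1 / z ^ j)) p = residue (polygamma_integrand n j) p"
  proof (rule residue_cong)
    have "eventually (\<lambda>z. z \<in> S - {p}) (at p)"
      by (rule eventually_at_in_open) (use assms in auto)
    thus "eventually (\<lambda>z. deriv (Polygamma n) z / Polygamma n z * (1 / z ^ j) = polygamma_integrand n j z) (at p)"
      by eventually_elim (use assms(6) in \<open>auto simp: polygamma_integrand_def deriv_Polygamma\<close>)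
  qed auto
  finally show ?thesis by simp
qed

lemma residue_polygamma_integrand_zero:
  assumes "n > 0" "p \<in> polygamma_zeros n"
  shows "residue (polygamma_integrand n j) p = of_int (polygamma_zero_order n p) / p ^ j"
proof -
  obtain g r where g: "r > 0" "ball p r \<subseteq> -\<int>\<^sub>\<le>\<^sub>0" "g holomorphic_on ball p r" "\<And>z. z \<in> ball p r \<Longrightarrow> g z \<noteq> 0"
    "\<And>z. z \<in> ball p r \<Longrightarrow> Polygamma n z = g z * (z - p) ^ nat (polygamma_zero_order n p)"
    "polygamma_zero_order n p > 0"
    using assms by (rule Polygamma_near_zero) (rule that; assumption)
  show ?thesis
  proof (rule residue_polygamma_integrand[of "ball p r" p g])
    show "p \<noteq> 0" using assms(2) by (auto simp: polygamma_zeros_def)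
    show "Polygamma n z = g z * (z - p) powi polygamma_zero_order n p" if "z \<in> ball p r - {p}" for z
      using g(5)[of z] g(6) that by (simp add: power_int_def)
  qed (use g in auto)
qed

lemma residue_polygamma_integrand_pole:
  assumes "m > 0"
  shows "residue (polygamma_integrand n j) (- of_nat m) = - of_nat (n + 1) / (- of_nat m) ^ j"
proof -
  define p :: complex where "p = - of_nat m"
  obtain g where g: "g holomorphic_on ball p 1" "g p = (-1) ^ Suc n * fact n"
    "\<And>z. z \<in> ball p 1 - {p} \<Longrightarrow> Polygamma n z = g z / (z - p) ^ Suc n"
    unfolding p_def using Polygamma_near_pole[of m n] by blast
  have "isCont g p"
    using g(1) by (intro continuous_on_interior[OF holomorphic_on_imp_continuous_on]) auto
  hence "eventually (\<lambda>z. g z \<noteq> 0) (nhds p)"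
    unfolding isCont_def tendsto_at_iff_tendsto_nhds
    by (rule tendsto_imp_eventually_ne) (simp add: g(2))
  then obtain r where r: "r > 0" "\<And>z. z \<in> ball p r \<Longrightarrow> g z \<noteq> 0"
    by (auto simp: eventually_nhds_metric dist_commute)
  \<comment> \<open>Radius 1 keeps out the other poles, radius r the zeros of g.\<close>
  have sub: "ball p (min r 1) \<subseteq> ball p r" "ball p (min r 1) \<subseteq> ball p 1"
    by auto
  have "residue (polygamma_integrand n j) p = of_int (- int (Suc n)) / p ^ j"
  proof (rule residue_polygamma_integrand[of "ball p (min r 1)" p g])
    show "z \<notin> \<int>\<^sub>\<le>\<^sub>0" if z: "z \<in> ball p (min r 1) - {p}" for z
      using z sub nonpos_Ints_isolated[of z m] by (auto simp: p_def)
    show "Polygamma n z = g z * (z - p) powi - int (Suc n)" if "z \<in> ball p (min r 1) - {p}" for z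
      using g(3)[of z] that by (simp add: power_int_minus divide_inverse del: of_nat_Suc)
  qed (use assms g(1) r sub in \<open>auto simp: p_def intro: holomorphic_on_subset\<close>)
  thus ?thesis by (simp add: p_def)
qed

lemma Polygamma_1_conv_zeta:
  assumes "n > 0"
  shows "Polygamma n 1 = (-1) ^ Suc n * fact n * zeta (of_nat (Suc n))"
proof -
  have "(\<lambda>k. inverse ((1 + of_nat k :: complex) ^ Suc n)) sums ((-1) ^ Suc n * Polygamma n 1 / fact n)"
    by (rule Polygamma_LIMSEQ) (use assms in auto)
  moreover have "inverse ((1 + of_nat k :: complex) ^ Suc n) = 1 / of_nat (Suc k) powr of_nat (Suc n)" for k
  proof -
    have "(of_nat (Suc k) :: complex) powr of_nat (Suc n) = of_nat (Suc k) ^ Suc n"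
      by (rule powr_complexpow) (simp del: of_nat_Suc)
    thus ?thesis by (simp add: divide_inverse)
  qed
  ultimately have "zeta (of_nat (Suc n)) = (-1) ^ Suc n * Polygamma n 1 / fact n"
    unfolding zeta_def by (simp only: sums_iff)
  thus ?thesis
    by (cases "even n") simp_all
qed

text \<open>Near 0 the logarithmic derivative is -(n+1)/z + (n+1) zeta(n+1) z^n + O(z^(n+1)). After
  division by z^j with 1 <= j <= n+1, a term in 1/z appears only for j = n+1.\<close>

definition polygamma_residue_0 :: "nat \<Rightarrow> nat \<Rightarrow> complex" where
  "polygamma_residue_0 n j = (if j = Suc n then of_nat (Suc n) * zeta (of_nat (Suc n)) else 0)"

lemma residue_polygamma_integrand_0:
  assumes n: "n > 0" and j: "1 \<le> j" "j \<le> Suc n"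
  shows "residue (polygamma_integrand n j) 0 = polygamma_residue_0 n j"
proof -
  define c :: complex where "c = (-1) ^ Suc n * fact n"
  define q where "q = (\<lambda>z. Polygamma n (z + 1) :: complex)"
  define q' where "q' = (\<lambda>z. Polygamma (Suc n) (z + 1) :: complex)"
  \<comment> \<open>By the recurrence from z to z + 1, \<open>Polygamma n z\<close> is
    \<open>D z / z ^ Suc n\<close> with \<open>D 0 = c\<close> nonzero. The function R below is
    chosen such that D'/D = z^n R.\<close>
  define D where "D = (\<lambda>z. z ^ Suc n * q z + c)"
  define R where "R = (\<lambda>z. (z * q' z + of_nat (Suc n) * q z) / D z)"
  have notin: "z + 1 \<notin> \<int>\<^sub>\<le>\<^sub>0" if "z \<in> ball 0 1" for z :: complex
  proof
    assume "z + 1 \<in> \<int>\<^sub>\<le>\<^sub>0"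
    then obtain m where "z + 1 = - of_nat m" by (rule nonpos_Ints_complex_cases)
    hence "Re (z + 1) = - real m" by simp
    moreover have "\<bar>Re z\<bar> < 1"
      using that abs_Re_le_cmod[of z] by simp
    ultimately show False by simp
  qed
  have holo: "q holomorphic_on ball 0 1" "q' holomorphic_on ball 0 1"
    unfolding q_def q'_def using notin
    by (intro analytic_imp_holomorphic analytic_on_Polygamma' analytic_intros; simp)+
  have D_holo: "D holomorphic_on ball 0 1"
    unfolding D_def by (intro holomorphic_intros holo)
  have c: "c \<noteq> 0" by (simp add: c_def)
  have D0: "D 0 = c" by (simp add: D_def)
  have "isCont D 0"
    using D_holo by (intro continuous_on_interior[OF holomorphic_on_imp_continuous_on]) auto
  hence "eventually (\<lambda>z. D z \<noteq> 0) (nhds 0)"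
    unfolding isCont_def tendsto_at_iff_tendsto_nhds
    by (rule tendsto_imp_eventually_ne) (simp add: D0 c)
  then obtain r where r: "r > 0" "\<And>z. z \<in> ball 0 r \<Longrightarrow> D z \<noteq> 0"
    by (auto simp: eventually_nhds_metric)
  define S where "S = ball (0::complex) (min r 1)"
  have S: "open S" "0 \<in> S" "S \<subseteq> ball 0 1"
    using r by (auto simp: S_def)
  have D_nz: "D z \<noteq> 0" if "z \<in> S" for z
    using r(2)[of z] that by (simp add: S_def)
  have R_holo: "R holomorphic_on S"
    unfolding R_def using D_nz S(3) holo D_holo
    by (intro holomorphic_intros) (auto intro: holomorphic_on_subset)
  have eq: "polygamma_integrand n j z = - of_nat (Suc n) / z ^ Suc j + R z * z ^ n / z ^ j" if z: "z \<in> S - {0}" for z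
  proof -
    have z0: "z \<noteq> 0" using z by auto
    define w X where "w = z ^ Suc n" and "X = z ^ (n + 2) * q' z - of_nat (Suc n) * c"
    have w: "w \<noteq> 0" "z ^ (n + 2) = z * w" using z0 by (simp_all add: w_def)
    have "Polygamma n z = D z / w"
      using z0 unfolding w_def D_def q_def c_def Polygamma_plus1[OF z0, of n]
      by (simp add: ring_distribs add_divide_distrib)
    moreover have "Polygamma (Suc n) z = X / (z * w)"
      using z0 unfolding w(2)[symmetric] X_def q'_def c_def Polygamma_plus1[OF z0, of "Suc n"]
      by (simp add: ring_distribs add_divide_distrib diff_divide_distrib)
    ultimately have "Polygamma (Suc n) z / Polygamma n z = X / (z * D z)"
      using w(1) by simp
    also have "X = z ^ Suc n * (z * q' z + of_nat (Suc n) * q z) - of_nat (Suc n) * D z"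
      by (simp add: X_def D_def algebra_simps)
    also have "\<dots> / (z * D z) = - of_nat (Suc n) / z + R z * z ^ n"
      using z0 D_nz[of z] z unfolding R_def by (simp add: diff_divide_distrib mult.commute del: of_nat_Suc)
    finally show ?thesis
      unfolding polygamma_integrand_def by (simp add: add_divide_distrib)
  qed
  have "residue (polygamma_integrand n j) 0 = residue (\<lambda>z. - of_nat (Suc n) / z ^ Suc j + R z * z ^ n / z ^ j) 0"
  proof (rule residue_cong)
    have "eventually (\<lambda>z. z \<in> S - {0}) (at 0)"
      by (rule eventually_at_in_open) (use S in auto)
    thus "eventually (\<lambda>z. polygamma_integrand n j z = - of_nat (Suc n) / z ^ Suc j + R z * z ^ n / z ^ j) (at 0)"
      by eventually_elim (rule eq)
  qed auto
  also have "\<dots> = residue (\<lambda>z. - of_nat (Suc n) / z ^ Suc j) 0 + residue (\<lambda>z. R z * z ^ n / z ^ j) 0"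
    using S(1,2)
  proof (rule residue_add)
    show "(\<lambda>z. R z * z ^ n / z ^ j) holomorphic_on S - {0}"
      by (intro holomorphic_intros holomorphic_on_subset[OF R_holo]) auto
  qed (auto intro!: holomorphic_intros)
  also have "residue (\<lambda>z. - of_nat (Suc n) / z ^ Suc j) 0 = 0"
    by (subst residue_holomorphic_over_power'[of UNIV]) (use j in auto)
  also have "residue (\<lambda>z. R z * z ^ n / z ^ j) 0 = polygamma_residue_0 n j"
  proof (cases "j = Suc n")
    case False
    hence "j \<le> n" using j by simp
    have "residue (\<lambda>z. R z * z ^ n / z ^ j) 0 = residue (\<lambda>z. R z * z ^ (n - j)) 0"
    proof (rule residue_cong)
      have "eventually (\<lambda>z. z \<in> UNIV - {0::complex}) (at 0)"
        by (rule eventually_at_in_open) auto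
      thus "eventually (\<lambda>z. R z * z ^ n / z ^ j = R z * z ^ (n - j)) (at 0)"
        by eventually_elim (use \<open>j \<le> n\<close> in \<open>simp add: power_diff\<close>)
    qed auto
    also have "\<dots> = 0"
      by (rule residue_holo[OF S(1,2)]) (intro holomorphic_intros R_holo)
    finally show ?thesis using False by (simp add: polygamma_residue_0_def)
  next
    case True
    have "residue (\<lambda>z. R z * z ^ n / z ^ j) 0 = residue (\<lambda>z. R z / (z - 0)) 0"
    proof (rule residue_cong)
      have "eventually (\<lambda>z. z \<in> UNIV - {0::complex}) (at 0)"
        by (rule eventually_at_in_open) auto
      thus "eventually (\<lambda>z. R z * z ^ n / z ^ j = R z / (z - 0)) (at 0)"
        by eventually_elim (simp add: True)
    qed auto
    also have "\<dots> = R 0"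
      by (rule residue_simple[OF S(1,2) R_holo])
    also have "\<dots> = of_nat (Suc n) * zeta (of_nat (Suc n))"
      using c unfolding R_def D0 q_def by (simp add: Polygamma_1_conv_zeta[OF n] del: of_nat_Suc power_Suc flip: c_def)
    finally show ?thesis using True by (simp add: polygamma_residue_0_def)
  qed
  finally show ?thesis by simp
qed

section \<open>Integration over squares\<close>

text \<open>Only the left edge crosses the half-line containing the poles; its abscissa x - N lies
  strictly between -N and 1 - N when 0 < x < 1. The other edges need no shift.\<close>

definition square_path :: "real \<Rightarrow> nat \<Rightarrow> real \<Rightarrow> complex" where
  "square_path x N = rectpath (Complex (x - real N) (- real N)) (Complex (real N) (real N))"

definition square_box :: "real \<Rightarrow> nat \<Rightarrow> complex set" where
  "square_box x N = box (Complex (x - real N) (- real N)) (Complex (real N) (real N))"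

text \<open>The residues of \<open>polygamma_integrand n j\<close> inside the square, apart from the
  one at 0. The nonzero poles enclosed are -1, ..., -(N - 1).\<close>

definition square_sum :: "nat \<Rightarrow> real \<Rightarrow> nat \<Rightarrow> nat \<Rightarrow> complex" where
  "square_sum n x j N = (\<Sum>z\<in>polygamma_zeros n \<inter> square_box x N. of_int (polygamma_zero_order n z) / z ^ j)
     - of_nat (n + 1) * (\<Sum>m=1..N-1. 1 / (- of_nat m) ^ j)"

lemma nonpos_Ints_square_box:
  assumes "x \<in> {0<..<1}" "N > 0"
  shows "\<int>\<^sub>\<le>\<^sub>0 \<inter> square_box x N = insert 0 ((\<lambda>m. - of_nat m) ` {1..N-1})"
proof (intro equalityI subsetI)
  fix z assume z: "z \<in> \<int>\<^sub>\<le>\<^sub>0 \<inter> square_box x N"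
  then obtain m where m: "z = - of_nat m" by (auto elim: nonpos_Ints_complex_cases)
  have "real m < real N - x" using z by (simp add: m square_box_def in_box_complex_iff)
  hence "real m < real N" using assms by simp
  hence "m < N" by simp
  thus "z \<in> insert 0 ((\<lambda>m. - of_nat m) ` {1..N-1})"
    by (cases "m = 0") (auto simp: m)
next
  fix z :: complex assume "z \<in> insert 0 ((\<lambda>m. - of_nat m) ` {1..N-1})"
  then obtain m where m: "m \<le> N - 1" "z = - of_nat m" by force
  have "m + 1 \<le> N" using m(1) assms(2) by linarith
  hence "real (m + 1) \<le> real N" by (simp only: of_nat_le_iff)
  thus "z \<in> \<int>\<^sub>\<le>\<^sub>0 \<inter> square_box x N"
    using assms by (auto simp: m(2) square_box_def in_box_complex_iff)
qed

lemma contour_integral_square_path: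
  assumes n: "n > 0" and x: "x \<in> {0<..<1}" and N: "N > 0" and j: "1 \<le> j" "j \<le> Suc n"
    and avoid: "path_image (square_path x N) \<inter> polygamma_sing n = {}"
  shows "contour_integral (square_path x N) (polygamma_integrand n j) =
           2 * of_real pi * \<i> * (polygamma_residue_0 n j + square_sum n x j N)"
proof -
  define a where "a = Complex (x - real N) (- real N)"
  define b where "b = Complex (real N) (real N)"
  \<comment> \<open>Points of the square satisfy |z| <= |Re z| + |Im z| <= 2N, so the ball contains
    it. \<open>pts\<close> uses the closed ball of the same radius, so that S - pts is free of
    singularities.\<close>
  define S where "S = ball (0::complex) (2 * real N + 1)"
  define pts where "pts = cball 0 (2 * real N + 1) \<inter> polygamma_sing n"
  have path: "square_path x N = rectpath a b" and box: "square_box x N = box a b"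
    by (simp_all add: square_path_def square_box_def a_def b_def)
  have le: "Re a \<le> Re b" "Im a \<le> Im b"
    using x N by (simp_all add: a_def b_def)
  have fin: "finite pts"
    unfolding pts_def by (rule finite_polygamma_sing[OF n])
  have cbox: "cbox a b \<subseteq> S"
  proof
    fix z assume "z \<in> cbox a b"
    hence "\<bar>Re z\<bar> \<le> real N" "\<bar>Im z\<bar> \<le> real N"
      using x by (auto simp: in_cbox_complex_iff a_def b_def)
    thus "z \<in> S" using cmod_le[of z] by (simp add: S_def)
  qed
  have "path_image (rectpath a b) \<subseteq> cbox a b"
    by (rule path_image_rectpath_subset_cbox[OF le])
  hence img: "path_image (rectpath a b) \<subseteq> S - pts"
    using cbox avoid by (auto simp: path pts_def)
  have img': "path_image (rectpath a b) = cbox a b - box a b"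
    by (rule path_image_rectpath_cbox_minus_box[OF le])
  have wn0: "winding_number (rectpath a b) z = 0" if "z \<notin> cbox a b" for z
    by (rule winding_number_rectpath_outside[OF le that])
  have "contour_integral (rectpath a b) (polygamma_integrand n j) = 
          of_real (2 * pi) * \<i> * (\<Sum>p\<in>pts. winding_number (rectpath a b) p * residue (polygamma_integrand n j) p)"
  proof (rule Residue_theorem[of S])
    have "z \<notin> \<int>\<^sub>\<le>\<^sub>0 \<and> Polygamma n z \<noteq> 0 \<and> z \<noteq> 0" if "z \<in> S - pts" for z
      using that by (auto simp: S_def pts_def polygamma_zeros_def)
    thus "polygamma_integrand n j holomorphic_on S - pts"
      unfolding polygamma_integrand_def [abs_def] by (intro holomorphic_intros) auto
    show "\<forall>z. z \<notin> S \<longrightarrow> winding_number (rectpath a b) z = 0"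
      using wn0 cbox by blast
  qed (use fin img in \<open>auto simp: S_def\<close>)
  also have "(\<Sum>p\<in>pts. winding_number (rectpath a b) p * residue (polygamma_integrand n j) p) =
             (\<Sum>p\<in>pts \<inter> box a b. residue (polygamma_integrand n j) p)"
  proof (rule sum.mono_neutral_cong_right[OF fin])
    show "\<forall>p\<in>pts - pts \<inter> box a b. winding_number (rectpath a b) p * residue (polygamma_integrand n j) p = 0"
      using wn0 img img' by fastforce
    show "winding_number (rectpath a b) p * residue (polygamma_integrand n j) p = residue (polygamma_integrand n j) p"
      if "p \<in> pts \<inter> box a b" for p
      using that winding_number_rectpath[of p a b] by simp
  qed auto
  also have "pts \<inter> box a b = polygamma_zeros n \<inter> box a b \<union> \<int>\<^sub>\<le>\<^sub>0 \<inter> box a b"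
  proof -
    have "box a b \<subseteq> cball 0 (2 * real N + 1)"
      using cbox box_subset_cbox[of a b] ball_subset_cball unfolding S_def by blast
    thus ?thesis unfolding pts_def by blast
  qed
  also have "(\<Sum>p\<in>\<dots>. residue (polygamma_integrand n j) p) = 
      (\<Sum>p\<in>polygamma_zeros n \<inter> box a b. residue (polygamma_integrand n j) p) +
      (\<Sum>p\<in>\<int>\<^sub>\<le>\<^sub>0 \<inter> box a b. residue (polygamma_integrand n j) p)"
  proof (rule sum.union_disjoint)
    have "finite (pts \<inter> box a b)" using fin by simp
    thus "finite (polygamma_zeros n \<inter> box a b)" "finite (\<int>\<^sub>\<le>\<^sub>0 \<inter> box a b)"
      unfolding \<open>pts \<inter> box a b = _\<close> by simp_all
  qed (auto simp: polygamma_zeros_def)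
  also have "(\<Sum>p\<in>polygamma_zeros n \<inter> box a b. residue (polygamma_integrand n j) p) =
             (\<Sum>p\<in>polygamma_zeros n \<inter> box a b. of_int (polygamma_zero_order n p) / p ^ j)"
    by (intro sum.cong refl residue_polygamma_integrand_zero n) auto
  also have "(\<Sum>p\<in>\<int>\<^sub>\<le>\<^sub>0 \<inter> box a b. residue (polygamma_integrand n j) p) = 
             polygamma_residue_0 n j + (\<Sum>p\<in>(\<lambda>m. - of_nat m) ` {1..N-1}. residue (polygamma_integrand n j) p)"
    unfolding nonpos_Ints_square_box[OF x N, unfolded box]
    by (subst sum.insert) (auto simp: residue_polygamma_integrand_0[OF n j])
  also have "(\<Sum>p\<in>(\<lambda>m. - of_nat m) ` {1..N-1}. residue (polygamma_integrand n j) p) =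
             (\<Sum>m=1..N-1. residue (polygamma_integrand n j) (- of_nat m))"
    by (subst sum.reindex) (auto simp: inj_on_def)
  also have "\<dots> = (\<Sum>m=1..N-1. - of_nat (n + 1) * (1 / (- of_nat m) ^ j))"
    by (intro sum.cong refl) (simp add: residue_polygamma_integrand_pole del: of_nat_Suc of_nat_add)
  also have "\<dots> = - of_nat (n + 1) * (\<Sum>m=1..N-1. 1 / (- of_nat m) ^ j)"
    by (rule sum_distrib_left[symmetric])
  finally show ?thesis
    unfolding path square_sum_def box by (simp add: algebra_simps)
qed

lemma continuous_on_polygamma_integrand:
  assumes "T \<inter> polygamma_sing n = {}"
  shows "continuous_on T (polygamma_integrand n j)"
proof -
  have "z \<notin> \<int>\<^sub>\<le>\<^sub>0 \<and> Polygamma n z \<noteq> 0 \<and> z \<noteq> 0" if "z \<in> T" for z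
  proof -
    have "z \<notin> polygamma_sing n" using assms that by blast
    thus ?thesis by (auto simp: polygamma_zeros_def)
  qed
  hence nz: "\<And>z. z \<in> T \<Longrightarrow> z \<notin> \<int>\<^sub>\<le>\<^sub>0" "\<And>z. z \<in> T \<Longrightarrow> Polygamma n z \<noteq> 0" "\<And>z. z \<in> T \<Longrightarrow> z \<noteq> 0"
    by blast+
  have "isCont (polygamma_integrand n j) z" if "z \<in> T" for z
    unfolding polygamma_integrand_def [abs_def] using nz[OF that]
    by (intro continuous_intros) auto
  thus ?thesis
    by (intro continuous_at_imp_continuous_on) blast
qed

text \<open>The left edge is cut at heights y and -y: its middle piece has length 2y and carries the
  bound B, all other pieces have total length at most 8N and carry the bound A.\<close>

lemma contour_integral_square_path_le:
  fixes f :: "complex \<Rightarrow> complex" and N :: nat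
  assumes x: "x \<in> {0<..<1}" and y: "0 \<le> y" "y \<le> real N" and N: "N > 0"
    and cont: "continuous_on (path_image (square_path x N)) f"
    and A: "A \<ge> 0" "\<And>z. z \<in> path_image (square_path x N) \<Longrightarrow> Re z = x - real N \<longrightarrow> \<bar>Im z\<bar> \<ge> y \<Longrightarrow> norm (f z) \<le> A"
    and B: "B \<ge> 0" "\<And>t. \<bar>t\<bar> \<le> y \<Longrightarrow> norm (f (Complex (x - real N) t)) \<le> B"
  shows "norm (contour_integral (square_path x N) f) \<le> A * (8 * real N) + B * (2 * y)"
proof -
  define a1 a2 a3 a4 where "a1 = Complex (x - real N) (- real N)" and "a2 = Complex (real N) (- real N)"
    and "a3 = Complex (real N) (real N)" and "a4 = Complex (x - real N) (real N)"
  define b c where "b = Complex (x - real N) y" and "c = Complex (x - real N) (-y)"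
  have N': "real N > 0" using N by simp
  have path: "square_path x N = linepath a1 a2 +++ linepath a2 a3 +++ linepath a3 a4 +++ linepath a4 a1"
    by (simp add: square_path_def rectpath_def Let_def a1_def a2_def a3_def a4_def)
  have img: "path_image (square_path x N) = closed_segment a1 a2 \<union> closed_segment a2 a3 \<union> closed_segment a3 a4 \<union> closed_segment a4 a1"
    unfolding path by (simp add: path_image_join Un_assoc)
  have seg: "closed_segment a4 b \<subseteq> closed_segment a4 a1" "closed_segment b c \<subseteq> closed_segment a4 a1" "closed_segment c a1 \<subseteq> closed_segment a4 a1"
    "b \<in> closed_segment a4 a1" "c \<in> closed_segment b a1"
    "closed_segment b a1 \<subseteq> closed_segment a4 a1"
    using y by (auto simp: closed_segment_same_Re a4_def a1_def b_def c_def closed_segment_eq_real_ivl)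
  have cont': "continuous_on T f" if "T \<subseteq> path_image (square_path x N)" for T
    using cont that by (rule continuous_on_subset)
  have ci: "f contour_integrable_on linepath u v" if "closed_segment u v \<subseteq> path_image (square_path x N)" for u v
    by (intro contour_integrable_continuous_linepath cont' that)
  have sub: "closed_segment a1 a2 \<subseteq> path_image (square_path x N)" "closed_segment a2 a3 \<subseteq> path_image (square_path x N)"
    "closed_segment a3 a4 \<subseteq> path_image (square_path x N)" "closed_segment a4 a1 \<subseteq> path_image (square_path x N)"
    unfolding img by blast+
  have "contour_integral (square_path x N) f = contour_integral (linepath a1 a2) f + (contour_integral (linepath a2 a3) f +
          (contour_integral (linepath a3 a4) f + contour_integral (linepath a4 a1) f))"
    unfolding path by (simp add: ci sub)
  also have "contour_integral (linepath a4 a1) f = contour_integral (linepath a4 b) f + contour_integral (linepath b a1) f"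
    by (intro contour_integral_split_linepath cont' sub seg)
  also have "contour_integral (linepath b a1) f = contour_integral (linepath b c) f + contour_integral (linepath c a1) f"
    using seg sub by (intro contour_integral_split_linepath cont') auto
  finally have eq: "contour_integral (square_path x N) f = contour_integral (linepath a1 a2) f + (contour_integral (linepath a2 a3) f +
          (contour_integral (linepath a3 a4) f + (contour_integral (linepath a4 b) f + (contour_integral (linepath b c) f + contour_integral (linepath c a1) f))))" .
  have bound: "norm (contour_integral (linepath u v) f) \<le> A * L"
    if "closed_segment u v \<subseteq> path_image (square_path x N)" "\<And>z. z \<in> closed_segment u v \<Longrightarrow> Re z = x - real N \<longrightarrow> \<bar>Im z\<bar> \<ge> y"
      "norm (v - u) \<le> L" for u v L
  proof -
    have "norm (contour_integral (linepath u v) f) \<le> A * norm (v - u)"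
      by (intro contour_integral_bound_linepath ci that A) (use that in blast)
    also have "\<dots> \<le> A * L"
      by (intro mult_left_mono that A)
    finally show ?thesis .
  qed
  have "norm (contour_integral (linepath a1 a2) f) \<le> A * (2 * real N)"
  proof (intro bound sub)
    show "norm (a2 - a1) \<le> 2 * real N"
      using cmod_le[of "a2 - a1"] x N' by (simp add: a1_def a2_def)
  qed (use y x N' in \<open>auto simp: closed_segment_same_Im a1_def a2_def\<close>)
  moreover have "norm (contour_integral (linepath a2 a3) f) \<le> A * (2 * real N)"
  proof (intro bound sub)
    show "norm (a3 - a2) \<le> 2 * real N"
      using cmod_le[of "a3 - a2"] x N' by (simp add: a3_def a2_def)
  qed (use y x N' in \<open>auto simp: closed_segment_same_Re a3_def a2_def\<close>)
  moreover have "norm (contour_integral (linepath a3 a4) f) \<le> A * (2 * real N)"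
  proof (intro bound sub)
    show "norm (a4 - a3) \<le> 2 * real N"
      using cmod_le[of "a4 - a3"] x N' by (simp add: a3_def a4_def)
  qed (use y x N' in \<open>auto simp: closed_segment_same_Im a3_def a4_def\<close>)
  moreover have "norm (contour_integral (linepath a4 b) f) \<le> A * real N"
  proof (intro bound)
    show "norm (b - a4) \<le> real N"
      using cmod_le[of "b - a4"] y by (simp add: b_def a4_def)
    show "closed_segment a4 b \<subseteq> path_image (square_path x N)"
      using seg sub by blast
  qed (use y in \<open>auto simp: closed_segment_same_Re closed_segment_eq_real_ivl b_def a4_def split: if_splits\<close>)
  moreover have "norm (contour_integral (linepath c a1) f) \<le> A * real N"
  proof (intro bound)
    show "norm (a1 - c) \<le> real N"
      using cmod_le[of "a1 - c"] y by (simp add: c_def a1_def)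
    show "closed_segment c a1 \<subseteq> path_image (square_path x N)"
      using seg sub by blast
  qed (use y in \<open>auto simp: closed_segment_same_Re closed_segment_eq_real_ivl c_def a1_def split: if_splits\<close>)
  moreover have "norm (contour_integral (linepath b c) f) \<le> B * (2 * y)"
  proof -
    have "norm (contour_integral (linepath b c) f) \<le> B * norm (c - b)"
    proof (intro contour_integral_bound_linepath ci B(1))
      show "closed_segment b c \<subseteq> path_image (square_path x N)"
        using seg sub by blast
      fix z assume "z \<in> closed_segment b c"
      hence "Re z = x - real N" "\<bar>Im z\<bar> \<le> y"
        using y by (auto simp: closed_segment_same_Re closed_segment_eq_real_ivl b_def c_def split: if_splits)
      thus "norm (f z) \<le> B"
        using B(2)[of "Im z"] by (metis complex.collapse)
    qed
    also have "norm (c - b) \<le> 2 * y"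
      using cmod_le[of "c - b"] y by (simp add: b_def c_def)
    finally show ?thesis using B(1) by (simp add: mult_left_mono)
  qed
  ultimately have "norm (contour_integral (square_path x N) f) \<le> 
      A * (2 * real N) + (A * (2 * real N) + (A * (2 * real N) + (A * real N + (B * (2 * y) + A * real N))))"
    unfolding eq by (intro norm_triangle_le add_mono)
  also have "\<dots> = A * (8 * real N) + B * (2 * y)"
    by (simp add: algebra_simps)
  finally show ?thesis .
qed

lemma square_path_cases:
  assumes "x \<in> {0<..<1}" "N > 0" "z \<in> path_image (square_path x N)"
  shows "norm z \<ge> real N - 1" "norm z \<le> 2 * real N"
    "z \<notin> \<int>\<^sub>\<le>\<^sub>0" "Re z \<ge> 0 \<or> \<bar>Im z\<bar> = real N \<or> Re z = x - real N" 
proof -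
  have N: "real N \<ge> 1" using assms(2) by simp
  have le: "x - real N \<le> real N" "- real N \<le> real N" using assms(1) N by auto
  have z: "Re z \<in> {x - real N, real N} \<and> \<bar>Im z\<bar> \<le> real N \<or> \<bar>Im z\<bar> = real N \<and> x - real N \<le> Re z \<and> Re z \<le> real N"
    using assms(3) le unfolding square_path_def by (subst (asm) path_image_rectpath) auto
  show "Re z \<ge> 0 \<or> \<bar>Im z\<bar> = real N \<or> Re z = x - real N" using z N by auto
  have "\<bar>Re z\<bar> \<ge> real N - 1 \<or> \<bar>Im z\<bar> \<ge> real N - 1" using z assms(1) N by auto
  thus "norm z \<ge> real N - 1"
    using abs_Re_le_cmod[of z] abs_Im_le_cmod[of z] by linarith
  have "\<bar>Re z\<bar> \<le> real N" "\<bar>Im z\<bar> \<le> real N" using z assms(1) N by auto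
  thus "norm z \<le> 2 * real N" using cmod_le[of z] by linarith
  show "z \<notin> \<int>\<^sub>\<le>\<^sub>0"
  proof
    assume "z \<in> \<int>\<^sub>\<le>\<^sub>0"
    then obtain m where m: "z = - of_nat m" by (rule nonpos_Ints_complex_cases)
    with z N have "x - real N = - real m" by auto
    hence "x = of_int (int N - int m)" by simp
    with assms(1) show False by (auto simp flip: of_int_0_less_iff simp del: of_int_of_nat_eq)
  qed
qed

lemma square_path_avoids_and_tendsto_0:
  assumes n: "n > 0" and j: "j \<ge> 1" and x: "x \<in> {0<..<1}"
    and pos: "Re (exp (2 * of_real pi * \<i> * of_real x) * - ((2 * of_real pi * \<i>) ^ Suc n)) > 0"
    and nz: "\<And>y. polygamma_reflection n (Complex x y) \<noteq> 0"
  shows "eventually (\<lambda>N. path_image (square_path x N) \<inter> polygamma_sing n = {}) sequentially"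
    and "(\<lambda>N. contour_integral (square_path x N) (polygamma_integrand n j)) \<longlonglongrightarrow> 0"
proof -
  obtain M N0 where M: "M > 0"
    "\<And>N y. N \<ge> N0 \<Longrightarrow> \<bar>y\<bar> \<le> sqrt (2 * real N) \<Longrightarrow>
       Polygamma n (Complex (x - real N) y) \<noteq> 0 \<and>
       norm (Polygamma (Suc n) (Complex (x - real N) y) / Polygamma n (Complex (x - real N) y)) \<le> M"
    using n x pos nz by (rule Polygamma_ratio_bounded_left) (rule that; assumption)
  have main: "eventually (\<lambda>N. path_image (square_path x N) \<inter> polygamma_sing n = {} \<and>
        norm (contour_integral (square_path x N) (polygamma_integrand n j)) \<le> 
           \<epsilon> / (real N - 1) * (8 * real N) + M / (real N - 1) * (2 * sqrt (2 * real N))) sequentially"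
    if \<epsilon>: "\<epsilon> > 0" for \<epsilon>
  proof -
    obtain R where R: "R > 0"
      "\<And>z::complex. norm z \<ge> R \<Longrightarrow> Re z \<ge> 0 \<or> \<bar>Im z\<bar> \<ge> sqrt (norm z) \<Longrightarrow> 
         Polygamma n z \<noteq> 0 \<and> norm (Polygamma (Suc n) z / Polygamma n z) \<le> \<epsilon>"
      using n \<epsilon> by (rule Polygamma_ratio_small) (rule that; assumption)
    show ?thesis
      \<comment> \<open>The added 2 ensures N - 1 >= R and N >= 2. The latter gives sqrt(2N) <= N,
        so the horizontal edges are high enough for the small bound.\<close>
      using eventually_ge_at_top[of N0] eventually_ge_at_top[of "nat \<lceil>R\<rceil> + 2"]
    proof eventually_elim
      case (elim N)
      hence N: "real N - 1 \<ge> 1" "real N - 1 \<ge> R" "N > 0" "N \<ge> N0" by linarith+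
      have "x < 1" using x by simp
      have sqrt_le: "sqrt (2 * real N) \<le> real N"
      proof (rule real_le_lsqrt)
        show "2 * real N \<le> (real N)\<^sup>2"
          using N(1) mult_right_mono[of 2 "real N" "real N"] by (simp add: power2_eq_square)
      qed auto
      have int_le: "norm (polygamma_integrand n j z) \<le> K / (real N - 1)"
        if "norm (Polygamma (Suc n) z / Polygamma n z) \<le> K" "norm z \<ge> real N - 1" for z K
      proof -
        have z: "norm z \<ge> 1" using N that by linarith
        have "norm z ^ 1 \<le> norm z ^ j"
          using z j by (intro power_increasing) auto
        hence "norm z ^ j \<ge> real N - 1" using that by simp
        hence "norm (Polygamma (Suc n) z / Polygamma n z) / norm z ^ j \<le> K / (real N - 1)"
          using that N z by (intro frac_le) (auto intro: order_trans[OF norm_ge_zero])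
        thus ?thesis
          unfolding polygamma_integrand_def by (simp only: norm_divide norm_power)
      qed
      \<comment> \<open>On the path |z| <= 2N, so heights from sqrt(2N) on meet the condition |Im z|
        >= sqrt |z|.\<close>
      have zone: "Polygamma n z \<noteq> 0 \<and> norm (Polygamma (Suc n) z / Polygamma n z) \<le> \<epsilon>"
        if z: "z \<in> path_image (square_path x N)" "Re z = x - real N \<longrightarrow> \<bar>Im z\<bar> \<ge> sqrt (2 * real N)" for z
      proof (rule R(2))
        note c = square_path_cases[OF x N(3) z(1)]
        show "norm z \<ge> R" using c N by linarith
        have "sqrt (norm z) \<le> sqrt (2 * real N)" using c(2) by simp
        thus "Re z \<ge> 0 \<or> \<bar>Im z\<bar> \<ge> sqrt (norm z)"
          using c(4) z(2) sqrt_le by linarith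
      qed
      have avoid: "path_image (square_path x N) \<inter> polygamma_sing n = {}"
      proof -
        have "z \<notin> polygamma_sing n" if z: "z \<in> path_image (square_path x N)" for z
        proof -
          have "Polygamma n z \<noteq> 0"
          proof (cases "Re z = x - real N \<longrightarrow> \<bar>Im z\<bar> \<ge> sqrt (2 * real N)")
            case True
            thus ?thesis using zone[OF z] by blast
          next
            case False
            thus ?thesis using M(2)[OF N(4), of "Im z"] by (metis complex.collapse linorder_linear)
          qed
          thus ?thesis using square_path_cases(3)[OF x N(3) z]
            by (simp add: polygamma_zeros_def)
        qed
        thus ?thesis by blast
      qed
      have "norm (contour_integral (square_path x N) (polygamma_integrand n j)) \<le> 
           \<epsilon> / (real N - 1) * (8 * real N) + M / (real N - 1) * (2 * sqrt (2 * real N))"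
      proof (rule contour_integral_square_path_le[OF x _ sqrt_le N(3)])
        show "continuous_on (path_image (square_path x N)) (polygamma_integrand n j)"
          by (rule continuous_on_polygamma_integrand[OF avoid])
        show "norm (polygamma_integrand n j z) \<le> \<epsilon> / (real N - 1)"
          if "z \<in> path_image (square_path x N)" "Re z = x - real N \<longrightarrow> \<bar>Im z\<bar> \<ge> sqrt (2 * real N)" for z
          using zone[OF that] square_path_cases(1)[OF x N(3) that(1)] by (intro int_le) auto
        show "norm (polygamma_integrand n j (Complex (x - real N) t)) \<le> M / (real N - 1)"
          if "\<bar>t\<bar> \<le> sqrt (2 * real N)" for t
        proof (rule int_le)
          show "norm (Complex (x - real N) t) \<ge> real N - 1"
            using abs_Re_le_cmod[of "Complex (x - real N) t"] \<open>x < 1\<close> unfolding complex.sel by linarith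
        qed (use M(2)[OF N(4) that] in auto)
      qed (use N \<epsilon> M(1) in auto)
      with avoid show ?case by blast
    qed
  qed
  show "eventually (\<lambda>N. path_image (square_path x N) \<inter> polygamma_sing n = {}) sequentially"
    using main[OF zero_less_one] by (rule eventually_mono) blast
  show "(\<lambda>N. contour_integral (square_path x N) (polygamma_integrand n j)) \<longlonglongrightarrow> 0"
  proof (rule tendstoI)
    fix e :: real assume e: "e > 0"
    \<comment> \<open>With the small parameter e / 16 the first term tends to 8 e / 16 = e / 2; the
      second is O(1 / sqrt N).\<close>
    have "((\<lambda>N. e / 16 / (real N - 1) * (8 * real N) + M / (real N - 1) * (2 * sqrt (2 * real N))) \<longlongrightarrow> e / 2) sequentially"
      by real_asymp
    moreover have "e / 2 < e" using e by simp
    ultimately have "eventually (\<lambda>N. e / 16 / (real N - 1) * (8 * real N) + M / (real N - 1) * (2 * sqrt (2 * real N)) < e) sequentially"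
      by (rule order_tendstoD)
    moreover have "e / 16 > 0" using e by simp
    note main[OF this]
    ultimately show "eventually (\<lambda>N. dist (contour_integral (square_path x N) (polygamma_integrand n j)) 0 < e) sequentially"
      by eventually_elim simp
  qed
qed

lemma square_sum_tendsto:
  assumes n: "n > 0" and j: "1 \<le> j" "j \<le> Suc n" and x: "x \<in> {0<..<1}"
    and pos: "Re (exp (2 * of_real pi * \<i> * of_real x) * - ((2 * of_real pi * \<i>) ^ Suc n)) > 0"
    and nz: "\<And>y. polygamma_reflection n (Complex x y) \<noteq> 0"
  shows "square_sum n x j \<longlonglongrightarrow> - polygamma_residue_0 n j"
proof -
  note * = square_path_avoids_and_tendsto_0[OF n j(1) x pos nz]
  have "(\<lambda>N. contour_integral (square_path x N) (polygamma_integrand n j) / (2 * of_real pi * \<i>) - polygamma_residue_0 n j)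
          \<longlonglongrightarrow> 0 / (2 * of_real pi * \<i>) - polygamma_residue_0 n j"
    by (intro tendsto_intros *(2)) auto
  moreover have "eventually (\<lambda>N. contour_integral (square_path x N) (polygamma_integrand n j) / (2 * of_real pi * \<i>)
      - polygamma_residue_0 n j = square_sum n x j N) sequentially"
    using *(1) eventually_gt_at_top[of 0]
  proof eventually_elim
    case (elim N)
    show ?case
      unfolding contour_integral_square_path[OF n x elim(2) j elim(1)] by simp
  qed
  ultimately have "square_sum n x j \<longlonglongrightarrow> 0 / (2 * of_real pi * \<i>) - polygamma_residue_0 n j"
    by (rule Lim_transform_eventually)
  thus ?thesis by simp
qed

section \<open>Summation in the order of the modulus\<close>

lemma zeta_sums:
  assumes "j \<ge> 2"
  shows "(\<lambda>k. 1 / of_nat (Suc k) ^ j) sums zeta (of_nat j)"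
proof -
  have "summable (\<lambda>k. inverse (of_nat k ^ j :: complex))"
    using assms by (rule inverse_power_summable)
  hence "summable (\<lambda>k. inverse (of_nat (Suc k) ^ j :: complex))"
    by (subst summable_Suc_iff)
  hence "summable (\<lambda>k. 1 / of_nat (Suc k) ^ j :: complex)"
    by (simp only: inverse_eq_divide)
  moreover have "of_nat (Suc k) powr of_nat j = (of_nat (Suc k) ^ j :: complex)" for k
    by (rule powr_complexpow) (simp del: of_nat_Suc)
  ultimately show ?thesis
    unfolding zeta_def by (simp only: summable_sums)
qed

text \<open>Elsewhere \<open>Polygamma_ratio_small\<close> excludes zeros. For |z| >= 2, the bound
  |Im z|^2 <= |z| leaves |Re z|^2 >= |z|^2 - |z| >= |z|^2 / 4.\<close>

lemma large_polygamma_zeros: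
  assumes "n > 0"
  obtains R where "R \<ge> 2" 
    "\<And>z. z \<in> polygamma_zeros n \<Longrightarrow> norm z \<ge> R \<Longrightarrow> \<bar>Im z\<bar> ^ 2 \<le> norm z \<and> - Re z \<ge> norm z / 2"
proof -
  obtain R where R: "R > 0"
    "\<And>z::complex. norm z \<ge> R \<Longrightarrow> Re z \<ge> 0 \<or> \<bar>Im z\<bar> \<ge> sqrt (norm z) \<Longrightarrow> 
       Polygamma n z \<noteq> 0 \<and> norm (Polygamma (Suc n) z / Polygamma n z) \<le> 1"
    using assms zero_less_one by (rule Polygamma_ratio_small) (rule that; assumption)
  show ?thesis
  proof (rule that[of "max 2 R"])
    fix z assume z: "z \<in> polygamma_zeros n" "norm z \<ge> max 2 R"
    hence *: "Re z < 0" "\<bar>Im z\<bar> < sqrt (norm z)"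
      using R(2)[of z] by (force simp: polygamma_zeros_def)+
    have "\<bar>Im z\<bar> ^ 2 \<le> sqrt (norm z) ^ 2"
      using *(2) by (intro power_mono) auto
    hence im: "\<bar>Im z\<bar> ^ 2 \<le> norm z" by simp
    have "norm z * 2 \<le> norm z * norm z"
      using z(2) by (intro mult_left_mono) auto
    moreover have "0 \<le> norm z * norm z" by simp
    ultimately have "norm z * norm z / 4 \<le> norm z * norm z - norm z" by linarith
    hence "(norm z / 2) ^ 2 \<le> norm z ^ 2 - norm z"
      by (simp add: power2_eq_square)
    also have "\<dots> \<le> (- Re z) ^ 2"
      using im cmod_power2[of z] by simp
    finally have "norm z / 2 \<le> - Re z"
      using *(1) by (intro power2_le_imp_le[of "norm z / 2"]) auto
    with im show "\<bar>Im z\<bar> ^ 2 \<le> norm z \<and> - Re z \<ge> norm z / 2" by blast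
  qed auto
qed

text \<open>There are b - a additional terms, each at most 1 / (a + 1). Hence moving the cutoff of
  the pole sum by a bounded amount is negligible even for j = 1.\<close>

lemma norm_pole_sum_diff_le:
  assumes "a \<le> b" "j \<ge> 1"
  shows "norm ((\<Sum>m=1..b. 1 / (- of_nat m) ^ j) - (\<Sum>m=1..a. 1 / (- of_nat m :: complex) ^ j)) \<le> real (b - a) / real (Suc a)"
proof -
  have "{1..b} = {1..a} \<union> {Suc a..b}" using assms by auto
  hence "(\<Sum>m=1..b. 1 / (- of_nat m :: complex) ^ j) = (\<Sum>m=1..a. 1 / (- of_nat m) ^ j) + (\<Sum>m=Suc a..b. 1 / (- of_nat m) ^ j)"
    by (simp only:) (rule sum.union_disjoint; force)
  hence "norm ((\<Sum>m=1..b. 1 / (- of_nat m) ^ j) - (\<Sum>m=1..a. 1 / (- of_nat m :: complex) ^ j)) = 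
           norm (\<Sum>m=Suc a..b. 1 / (- of_nat m :: complex) ^ j)"
    by simp
  also have "\<dots> \<le> real (card {Suc a..b}) * (1 / real (Suc a))"
  proof (rule sum_norm_bound)
    fix m assume m: "m \<in> {Suc a..b}"
    have "real (Suc a) \<le> real m" using m by simp
    also have "real m ^ 1 \<le> real m ^ j"
      using m assms by (intro power_increasing) auto
    finally have "1 / real m ^ j \<le> 1 / real (Suc a)"
      by (intro divide_left_mono mult_pos_pos zero_less_power) (use m in auto)
    thus "norm (1 / (- of_nat m :: complex) ^ j) \<le> 1 / real (Suc a)"
      by (simp add: norm_divide norm_power)
  qed
  finally show ?thesis by simp
qed

lemma finite_zeros_square_box:
  assumes "n > 0"
  shows "finite (polygamma_zeros n \<inter> square_box x N)"
proof (rule finite_subset)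
  show "finite (cball 0 (real N + \<bar>x - real N\<bar> + real N) \<inter> polygamma_sing n)"
    by (rule finite_polygamma_sing[OF assms])
  show "polygamma_zeros n \<inter> square_box x N \<subseteq> cball 0 (real N + \<bar>x - real N\<bar> + real N) \<inter> polygamma_sing n"
  proof
    fix z assume z: "z \<in> polygamma_zeros n \<inter> square_box x N"
    hence "\<bar>Re z\<bar> \<le> real N + \<bar>x - real N\<bar>" "\<bar>Im z\<bar> \<le> real N"
      by (auto simp: square_box_def in_box_complex_iff)
    thus "z \<in> cball 0 (real N + \<bar>x - real N\<bar> + real N) \<inter> polygamma_sing n"
      using z cmod_le[of z] by auto
  qed
qed

text \<open>With m the order, -Re(m/z) = m (-Re z) / |z|^2 is at least half of m / |z|, and |z| >= 1
  lets m / |z| dominate m / |z|^j.\<close>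

lemma zero_order_term_bound:
  assumes n: "n > 0" and z: "z \<in> polygamma_zeros n" "norm z \<ge> 1" "- Re z \<ge> norm z / 2" and j: "j \<ge> 1"
  shows "norm (of_int (polygamma_zero_order n z) / z ^ j) \<le> 2 * - Re (of_int (polygamma_zero_order n z) / z ^ 1)"
proof -
  define m where "m = real_of_int (polygamma_zero_order n z)"
  have "polygamma_zero_order n z > 0"
    using n z(1) by (rule Polygamma_near_zero)
  hence m: "m > 0" by (simp add: m_def)
  have "of_int (polygamma_zero_order n z) = complex_of_real m" by (simp add: m_def)
  moreover have "norm (of_real m / z ^ j) \<le> 2 * - Re (of_real m / z ^ 1)"
  proof -
    have "norm z ^ 1 \<le> norm z ^ j"
      using z j by (intro power_increasing) auto
    moreover have "norm z > 0" using z(2) by linarith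
    ultimately have "m / norm z ^ j \<le> m / norm z"
      using m by (intro divide_left_mono mult_pos_pos zero_less_power) auto
    hence "norm (of_real m / z ^ j) \<le> m / norm z"
      using m by (simp add: norm_divide norm_power)
    also have "m / norm z = 2 * (m * (norm z / 2)) / norm z ^ 2"
      using z(2) by (simp add: power2_eq_square)
    also have "\<dots> \<le> 2 * (m * - Re z) / norm z ^ 2"
      using m z by (intro divide_right_mono mult_left_mono) auto
    also have "\<dots> = 2 * - Re (of_real m / z ^ 1)"
      by (simp add: Re_divide cmod_power2)
    finally show ?thesis .
  qed
  ultimately show ?thesis by simp
qed

text \<open>
  The terms with \<open>j = 1\<close> have real parts of constant sign and comparable to their modulus, so their
  sum over the zeros between two squares controls the sum of all moduli.
\<close>

lemma norm_sum_zeros_le: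
  assumes n: "n > 0" and j: "j \<ge> 1" and N: "0 < N1" "N1 \<le> N2"
    and H: "polygamma_zeros n \<inter> square_box x N1 \<subseteq> H" "H \<subseteq> polygamma_zeros n \<inter> square_box x N2"
    and large: "\<And>z. z \<in> polygamma_zeros n \<Longrightarrow> z \<notin> square_box x N1 \<Longrightarrow> norm z \<ge> 1 \<and> - Re z \<ge> norm z / 2"
  shows "norm ((\<Sum>z\<in>H. of_int (polygamma_zero_order n z) / z ^ j) 
           - (\<Sum>z\<in>polygamma_zeros n \<inter> square_box x N1. of_int (polygamma_zero_order n z) / z ^ j))
         \<le> 2 * (norm (square_sum n x 1 N2 - square_sum n x 1 N1) + real (n + 1) * (real (N2 - N1) / real N1))"
proof -
  define B1 B2 where "B1 = polygamma_zeros n \<inter> square_box x N1" and "B2 = polygamma_zeros n \<inter> square_box x N2"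
  define f where "f = (\<lambda>(j::nat) z. of_int (polygamma_zero_order n z) / z ^ j :: complex)"
  have fin: "finite B1" "finite B2"
    unfolding B1_def B2_def by (intro finite_zeros_square_box n)+
  have sub: "B1 \<subseteq> H" "H \<subseteq> B2" using H by (simp_all add: B1_def B2_def)
  have fin_H: "finite H" using sub fin finite_subset by blast
  have "norm (sum (f j) H - sum (f j) B1) = norm (sum (f j) (H - B1))"
    using sub fin_H by (simp add: sum_diff)
  also have "\<dots> \<le> (\<Sum>z\<in>H - B1. norm (f j z))"
    by (rule norm_sum)
  \<comment> \<open>H is an arbitrary intermediate set, but only the full difference of the boxes is
    a difference of square sums; nonnegativity of the norms permits the enlargement.\<close>
  also have "\<dots> \<le> (\<Sum>z\<in>B2 - B1. norm (f j z))"
    using sub fin by (intro sum_mono2) auto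
  also have "\<dots> \<le> (\<Sum>z\<in>B2 - B1. 2 * - Re (f 1 z))"
  proof (rule sum_mono)
    fix z assume "z \<in> B2 - B1"
    hence "z \<in> polygamma_zeros n" "z \<notin> square_box x N1" by (auto simp: B1_def B2_def)
    with large show "norm (f j z) \<le> 2 * - Re (f 1 z)"
      unfolding f_def using n j by (intro zero_order_term_bound) auto
  qed
  also have "\<dots> = 2 * - Re (sum (f 1) (B2 - B1))"
    by (simp add: sum_distrib_left sum_negf)
  also have "\<dots> \<le> 2 * norm (sum (f 1) (B2 - B1))"
    using abs_Re_le_cmod[of "sum (f 1) (B2 - B1)"] by linarith
  also have "sum (f 1) (B2 - B1) = sum (f 1) B2 - sum (f 1) B1"
    using sub fin by (intro sum_diff) auto
  \<comment> \<open>The correction term accounts for the poles between the two squares.\<close>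
  also have "\<dots> = (square_sum n x 1 N2 - square_sum n x 1 N1) + 
      of_nat (n + 1) * ((\<Sum>m=1..N2-1. 1 / (- of_nat m) ^ 1) - (\<Sum>m=1..N1-1. 1 / (- of_nat m) ^ 1))"
    unfolding square_sum_def f_def B1_def B2_def by (simp add: algebra_simps)
  also have "norm \<dots> \<le> norm (square_sum n x 1 N2 - square_sum n x 1 N1) + real (n + 1) * (real (N2 - N1) / real N1)"
  proof (rule norm_triangle_le, rule add_left_mono)
    have "norm (of_nat (n + 1) * ((\<Sum>m=1..N2-1. 1 / (- of_nat m) ^ 1) - (\<Sum>m=1..N1-1. 1 / (- of_nat m) ^ 1) :: complex)) =
          real (n + 1) * norm ((\<Sum>m=1..N2-1. 1 / (- of_nat m) ^ 1) - (\<Sum>m=1..N1-1. 1 / (- of_nat m) ^ 1) :: complex)"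
      unfolding norm_mult norm_of_nat ..
    also have "\<dots> \<le> real (n + 1) * (real ((N2 - 1) - (N1 - 1)) / real (Suc (N1 - 1)))"
      using N by (intro mult_left_mono norm_pole_sum_diff_le) auto
    also have "(N2 - 1) - (N1 - 1) = N2 - N1"
      using N by auto
    also have "Suc (N1 - 1) = N1"
      using N by auto
    finally show "norm (of_nat (n + 1) * ((\<Sum>m=1..N2-1. 1 / (- of_nat m) ^ 1) - (\<Sum>m=1..N1-1. 1 / (- of_nat m) ^ 1) :: complex))
        \<le> real (n + 1) * (real (N2 - N1) / real N1)" .
  qed
  finally show ?thesis
    unfolding f_def B1_def by simp
qed

lemma norm_enumeration_at_top:
  assumes n: "n > 0" and \<eta>: "enumerates_polygamma_zeros n \<eta>"
  shows "filterlim (\<lambda>K. norm (\<eta> K)) at_top sequentially"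
  unfolding filterlim_at_top
proof
  fix R :: real
  have bij: "bij_betw \<eta> {1..} (polygamma_zeros n)"
    using \<eta> by (simp add: enumerates_polygamma_zeros_def)
  define A where "A = {k\<in>{1..}. norm (\<eta> k) \<le> R}"
  have "\<eta> ` A \<subseteq> cball 0 R \<inter> polygamma_sing n"
    using bij_betwE[OF bij] by (auto simp: A_def)
  hence "finite (\<eta> ` A)"
    using finite_polygamma_sing[OF n] finite_subset by blast
  moreover have "inj_on \<eta> A"
    using bij by (auto simp: bij_betw_def A_def intro: inj_on_subset)
  ultimately have "finite A"
    using finite_image_iff by blast
  then obtain k0 where k0: "\<And>k. k \<in> A \<Longrightarrow> k < k0"
    by (metis finite_nat_set_iff_bounded)
  show "eventually (\<lambda>K. R \<le> norm (\<eta> K)) sequentially"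
    using eventually_ge_at_top[of "max 1 k0"]
  proof eventually_elim
    case (elim K)
    have "K \<notin> A" using k0[of K] elim by auto
    thus ?case using elim by (auto simp: A_def)
  qed
qed

text \<open>For j = 1 the sign of -m turns the subtraction into an addition, so this is
  \<open>zero_pole_partial_sum\<close> with the true orders. A general j lets one limit argument
  serve all three claims.\<close>

definition signed_partial_sum :: "nat \<Rightarrow> nat \<Rightarrow> (nat \<Rightarrow> complex) \<Rightarrow> nat \<Rightarrow> complex" where
  "signed_partial_sum n j \<eta> K = (\<Sum>k=1..K. of_int (polygamma_zero_order n (\<eta> k)) / \<eta> k ^ j)
     - of_nat (n + 1) * (\<Sum>m=1..nat \<lfloor>norm (\<eta> K)\<rfloor>. 1 / (- of_nat m) ^ j)"

lemma tendsto_signed_partial_sum: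
  assumes n: "n > 0" and j: "1 \<le> j" "j \<le> Suc n" and \<eta>: "enumerates_polygamma_zeros n \<eta>"
  shows "signed_partial_sum n j \<eta> \<longlonglongrightarrow> - polygamma_residue_0 n j"
proof -
  have bij: "bij_betw \<eta> {1..} (polygamma_zeros n)" and mono: "\<And>i k. 1 \<le> i \<Longrightarrow> i \<le> k \<Longrightarrow> norm (\<eta> i) \<le> norm (\<eta> k)"
    using \<eta> by (auto simp: enumerates_polygamma_zeros_def)
  obtain x where x: "x \<in> {0<..<1}" "Re (exp (2 * of_real pi * \<i> * of_real x) * - ((2 * of_real pi * \<i>) ^ Suc n)) > 0"
    "\<And>y. polygamma_reflection n (Complex x y) \<noteq> 0"
    using n by (rule obtain_good_abscissa) (rule that; assumption)
  obtain R where R: "R \<ge> 2" 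
    "\<And>z. z \<in> polygamma_zeros n \<Longrightarrow> norm z \<ge> R \<Longrightarrow> \<bar>Im z\<bar> ^ 2 \<le> norm z \<and> - Re z \<ge> norm z / 2"
    using n by (rule large_polygamma_zeros) (rule that; assumption)
  define M where "M = (\<lambda>K. nat \<lfloor>norm (\<eta> K)\<rfloor>)"
  note top = norm_enumeration_at_top[OF n \<eta>]
  have M: "filterlim M at_top sequentially"
    unfolding M_def 
    by (rule filterlim_compose[OF filterlim_nat_sequentially filterlim_compose[OF filterlim_floor_sequentially top]])
  \<comment> \<open>The first part bounds the zeros between the squares M - 1 and M + 2, with 3 the
    difference of the indices. The second bounds the two poles -(M - 1) and -M, which the partial
    sum counts but the square M - 1 does not enclose.\<close>
  define err where "err = (\<lambda>M. 2 * (norm (square_sum n x 1 (M + 2) - square_sum n x 1 (M - 1)) + real (n + 1) * (3 / real (M - 1)))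
       + real (n + 1) * (2 / real (M - 1)))"
  have ev: "eventually (\<lambda>K. norm (signed_partial_sum n j \<eta> K - square_sum n x j (M K - 1)) \<le> err (M K)) sequentially"
    \<comment> \<open>With N the floor of the modulus, the 3 gives R < N - 2. Hence the disc of
      radius R lies in the box of index N - 1, whose left edge is at x - (N - 1) < -(N - 2).\<close>
    using eventually_ge_at_top[of 1] top[unfolded filterlim_at_top, rule_format, of "R + 3"]
  proof eventually_elim
    case (elim K)
    define N where "N = M K"
    have N: "real N \<le> norm (\<eta> K)" "norm (\<eta> K) < real N + 1" "real N - 1 > R" "N > 2"
    proof -
      have "real N = of_int \<lfloor>norm (\<eta> K)\<rfloor>" by (simp add: N_def M_def)
      thus "real N \<le> norm (\<eta> K)" "norm (\<eta> K) < real N + 1" "real N - 1 > R" "N > 2"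
        using elim R(1) by linarith+
    qed
    have N1: "real (N - 1) = real N - 1" using N(4) by simp
    define H where "H = \<eta> ` {1..K}"
    have inj: "inj_on \<eta> {1..K}"
      using bij by (auto simp: bij_betw_def intro: inj_on_subset)
    have sub1: "polygamma_zeros n \<inter> square_box x (N - 1) \<subseteq> H"
    proof
      fix z assume z: "z \<in> polygamma_zeros n \<inter> square_box x (N - 1)"
      \<comment> \<open>A large zero in this box has |Re z| <= N - 1 and |Im z|^2 <= |z|, so |z|^2 -
        |z| <= (N - 1)^2 < N (N - 1) and thus |z| < N. The inequality must be strict: zeros of the
        same modulus as the K-th one may be listed after it.\<close>
      have "norm z < norm (\<eta> K)"
      proof (cases "norm z \<ge> R")
        case False
        thus ?thesis using N by linarith
      next
        case True
        have "\<bar>Re z\<bar> \<le> real N - 1"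
          using z x(1) N1 by (auto simp: square_box_def in_box_complex_iff)
        hence "\<bar>Re z\<bar> ^ 2 \<le> (real N - 1) ^ 2"
          by (intro power_mono) auto
        moreover have "\<bar>Im z\<bar> ^ 2 \<le> norm z"
          using R(2)[of z] z True by blast
        ultimately have *: "norm z ^ 2 \<le> (real N - 1) ^ 2 + norm z"
          by (simp add: cmod_power2)
        have "norm z < real N"
        proof (rule ccontr)
          assume "\<not> norm z < real N"
          hence "real N * (real N - 1) \<le> norm z * (norm z - 1)"
            using N(4) by (intro mult_mono) auto
          moreover have "(real N - 1) * (real N - 1) < real N * (real N - 1)"
            using N(4) by (intro mult_strict_right_mono) auto
          ultimately show False
            using * by (simp add: power2_eq_square algebra_simps)
        qed
        thus ?thesis using N by linarith
      qed
      obtain i where i: "i \<ge> 1" "z = \<eta> i"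
        using z bij unfolding bij_betw_def by auto
      have "i \<le> K"
      proof (rule ccontr)
        assume "\<not> i \<le> K"
        hence "norm (\<eta> K) \<le> norm (\<eta> i)" using elim(1) by (intro mono) auto
        with \<open>norm z < norm (\<eta> K)\<close> i(2) show False by simp
      qed
      thus "z \<in> H" using i by (auto simp: H_def)
    qed
    \<comment> \<open>Index N + 1 would not suffice: the left edge of that box is at x - (N + 1), to
      the right of -(N + 1).\<close>
    have sub2: "H \<subseteq> polygamma_zeros n \<inter> square_box x (N + 2)"
    proof
      fix z assume "z \<in> H"
      then obtain i where i: "1 \<le> i" "i \<le> K" "z = \<eta> i" by (auto simp: H_def)
      have "norm z < real N + 1" using mono[OF i(1,2)] N(2) i(3) by simp
      hence "\<bar>Re z\<bar> < real N + 1" "\<bar>Im z\<bar> < real N + 1"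
        using abs_Re_le_cmod[of z] abs_Im_le_cmod[of z] by linarith+
      moreover have "z \<in> polygamma_zeros n"
        using bij_betwE[OF bij] i by simp
      ultimately show "z \<in> polygamma_zeros n \<inter> square_box x (N + 2)"
        using x(1) by (auto simp: square_box_def in_box_complex_iff)
    qed
    have large: "norm z \<ge> 1 \<and> - Re z \<ge> norm z / 2" if z: "z \<in> polygamma_zeros n" "z \<notin> square_box x (N - 1)" for z
    proof -
      have "norm z \<ge> R"
      proof (rule ccontr)
        assume "\<not> norm z \<ge> R"
        hence "\<bar>Re z\<bar> < real N - 2 + 1" "\<bar>Im z\<bar> < real N - 1" "\<bar>Re z\<bar> < R"
          using abs_Re_le_cmod[of z] abs_Im_le_cmod[of z] N by linarith+
        with z(2) show False
          using x(1) N elim(2) R(1) by (auto simp: square_box_def in_box_complex_iff N1)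
      qed
      thus ?thesis using R(1) R(2)[OF z(1)] by auto
    qed
    have "norm ((\<Sum>z\<in>H. of_int (polygamma_zero_order n z) / z ^ j) 
           - (\<Sum>z\<in>polygamma_zeros n \<inter> square_box x (N - 1). of_int (polygamma_zero_order n z) / z ^ j))
         \<le> 2 * (norm (square_sum n x 1 (N + 2) - square_sum n x 1 (N - 1)) + real (n + 1) * (real (N + 2 - (N - 1)) / real (N - 1)))"
      using N(4) by (intro norm_sum_zeros_le n j sub1 sub2 large) auto
    also have "N + 2 - (N - 1) = 3" using N(4) by simp
    finally have 1: "norm ((\<Sum>z\<in>H. of_int (polygamma_zero_order n z) / z ^ j) 
           - (\<Sum>z\<in>polygamma_zeros n \<inter> square_box x (N - 1). of_int (polygamma_zero_order n z) / z ^ j))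
         \<le> 2 * (norm (square_sum n x 1 (N + 2) - square_sum n x 1 (N - 1)) + real (n + 1) * (3 / real (N - 1)))"
      by simp
    have 2: "norm (of_nat (n + 1) * ((\<Sum>m=1..N. 1 / (- of_nat m) ^ j) - (\<Sum>m=1..N-1-1. 1 / (- of_nat m) ^ j) :: complex)) 
        \<le> real (n + 1) * (2 / real (N - 1))"
    proof -
      have "norm ((\<Sum>m=1..N. 1 / (- of_nat m) ^ j) - (\<Sum>m=1..N-1-1. 1 / (- of_nat m :: complex) ^ j)) \<le> real (N - (N - 1 - 1)) / real (Suc (N - 1 - 1))"
        by (rule norm_pole_sum_diff_le) (use j in auto)
      also have "N - (N - 1 - 1) = 2" using N(4) by auto
      also have "Suc (N - 1 - 1) = N - 1" using N(4) by auto
      finally have "norm ((\<Sum>m=1..N. 1 / (- of_nat m) ^ j) - (\<Sum>m=1..N-1-1. 1 / (- of_nat m :: complex) ^ j)) \<le> 2 / real (N - 1)"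
        by simp
      thus ?thesis
        unfolding norm_mult norm_of_nat by (intro mult_left_mono) auto
    qed
    have "(\<Sum>k=1..K. of_int (polygamma_zero_order n (\<eta> k)) / \<eta> k ^ j) = (\<Sum>z\<in>H. of_int (polygamma_zero_order n z) / z ^ j)"
      unfolding H_def by (subst sum.reindex[OF inj]) simp
    hence "signed_partial_sum n j \<eta> K - square_sum n x j (N - 1) = 
        ((\<Sum>z\<in>H. of_int (polygamma_zero_order n z) / z ^ j) 
           - (\<Sum>z\<in>polygamma_zeros n \<inter> square_box x (N - 1). of_int (polygamma_zero_order n z) / z ^ j))
        - of_nat (n + 1) * ((\<Sum>m=1..N. 1 / (- of_nat m) ^ j) - (\<Sum>m=1..N-1-1. 1 / (- of_nat m) ^ j))"
      unfolding signed_partial_sum_def square_sum_def N_def M_def by (simp add: algebra_simps)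
    also have "norm \<dots> \<le> err N"
      unfolding err_def by (rule order_trans[OF norm_triangle_ineq4 add_mono[OF 1 2]])
    finally show ?case by (simp only: N_def)
  qed
  have sq: "square_sum n x j' \<longlonglongrightarrow> - polygamma_residue_0 n j'" if "1 \<le> j'" "j' \<le> Suc n" for j'
    by (rule square_sum_tendsto[OF n that x])
  have shift: "filterlim (\<lambda>M::nat. M + 2) at_top at_top" "filterlim (\<lambda>M::nat. M - 1) at_top at_top"
    by (rule filterlim_add_const_nat_at_top filterlim_minus_const_nat_at_top)+
  have sq1: "(\<lambda>M. square_sum n x 1 (M + 2)) \<longlonglongrightarrow> - polygamma_residue_0 n 1" 
            "(\<lambda>M. square_sum n x 1 (M - 1)) \<longlonglongrightarrow> - polygamma_residue_0 n 1"
    by (rule filterlim_compose[OF sq shift(1)] filterlim_compose[OF sq shift(2)]; use n in simp)+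
  have inv: "(\<lambda>M. c / real (M - 1)) \<longlonglongrightarrow> 0" for c
  proof -
    have "(\<lambda>M. c / real M) \<longlonglongrightarrow> 0" by real_asymp
    from filterlim_compose[OF this shift(2)] show ?thesis .
  qed
  \<comment> \<open>For every j it is the convergence with exponent 1 that enters here: both square
    sums have the same limit.\<close>
  have "err \<longlonglongrightarrow> 2 * (norm (- polygamma_residue_0 n 1 - - polygamma_residue_0 n 1) + real (n + 1) * 0) + real (n + 1) * 0"
    unfolding err_def by (intro tendsto_intros sq1 inv)
  hence "err \<longlonglongrightarrow> 0" by simp
  from filterlim_compose[OF this M] have "(\<lambda>K. err (M K)) \<longlonglongrightarrow> 0" .
  from Lim_null_comparison[OF ev this] 
  have "(\<lambda>K. signed_partial_sum n j \<eta> K - square_sum n x j (M K - 1)) \<longlonglongrightarrow> 0" .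
  moreover have "(\<lambda>K. square_sum n x j (M K - 1)) \<longlonglongrightarrow> - polygamma_residue_0 n j"
    by (rule filterlim_compose[OF filterlim_compose[OF sq[OF j] shift(2)] M])
  ultimately have "(\<lambda>K. (signed_partial_sum n j \<eta> K - square_sum n x j (M K - 1)) + square_sum n x j (M K - 1)) 
      \<longlonglongrightarrow> 0 + - polygamma_residue_0 n j"
    by (rule tendsto_add)
  thus ?thesis by simp
qed

text \<open>For j >= 2 the pole sum converges on its own, to (-1)^j zeta(j), and can be split off
  from \<open>signed_partial_sum\<close>. The zeros are numbered from 1, hence
  \<open>Suc k\<close>.\<close>

lemma zero_power_sums:
  assumes n: "n > 0" and j: "2 \<le> j" "j \<le> Suc n" and \<eta>: "enumerates_polygamma_zeros n \<eta>"
  shows "(\<lambda>k. of_int (polygamma_zero_order n (\<eta> (Suc k))) / \<eta> (Suc k) ^ j) sums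
           ((-1) ^ j * of_nat (n + 1) * zeta (of_nat j) - polygamma_residue_0 n j)"
proof -
  have "filterlim (\<lambda>K. nat \<lfloor>norm (\<eta> K)\<rfloor>) at_top sequentially"
    by (rule filterlim_compose[OF filterlim_nat_sequentially 
          filterlim_compose[OF filterlim_floor_sequentially norm_enumeration_at_top[OF n \<eta>]]])
  moreover have "(\<lambda>M. \<Sum>m=1..M. 1 / (- of_nat m) ^ j) \<longlonglongrightarrow> (-1) ^ j * zeta (of_nat j)"
  proof -
    have "(\<Sum>m=1..M. 1 / (- of_nat m :: complex) ^ j) = (-1) ^ j * (\<Sum>k<M. 1 / of_nat (Suc k) ^ j)" for M
    proof -
      have "1 / (- of_nat m :: complex) ^ j = (-1) ^ j * (1 / of_nat m ^ j)" for m
        by (subst power_minus) (cases "even j"; simp)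
      hence "(\<Sum>m=1..M. 1 / (- of_nat m :: complex) ^ j) = (-1) ^ j * (\<Sum>m=1..M. 1 / of_nat m ^ j)"
        by (simp add: sum_distrib_left)
      thus ?thesis
        by (simp only: One_nat_def sum.atLeast1_atMost_eq)
    qed
    moreover have "(\<lambda>M. \<Sum>k<M. 1 / of_nat (Suc k) ^ j) \<longlonglongrightarrow> zeta (of_nat j)"
      using zeta_sums[OF j(1)] by (simp only: sums_def)
    ultimately show ?thesis
      by (simp only:) (rule tendsto_mult_left)
  qed
  ultimately have lim: "(\<lambda>K. \<Sum>m=1..nat \<lfloor>norm (\<eta> K)\<rfloor>. 1 / (- of_nat m) ^ j) \<longlonglongrightarrow> (-1) ^ j * zeta (of_nat j)"
    by (rule filterlim_compose[rotated])
  have "signed_partial_sum n j \<eta> \<longlonglongrightarrow> - polygamma_residue_0 n j"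
    using n j \<eta> by (intro tendsto_signed_partial_sum) auto
  from tendsto_add[OF this tendsto_mult_left[OF lim, of "of_nat (n + 1)"]]
  have "(\<lambda>K. \<Sum>k=1..K. of_int (polygamma_zero_order n (\<eta> k)) / \<eta> k ^ j) \<longlonglongrightarrow>
      - polygamma_residue_0 n j + of_nat (n + 1) * ((-1) ^ j * zeta (of_nat j))"
    by (simp add: signed_partial_sum_def)
  thus ?thesis
    unfolding sums_def by (simp only: One_nat_def sum.atLeast1_atMost_eq) (simp add: algebra_simps)
qed

theorem theorem4p1:
  fixes \<eta> :: "nat \<Rightarrow> nat \<Rightarrow> complex" and l :: "nat \<Rightarrow> nat \<Rightarrow> int"
  assumes zeros: "\<And>n. n \<ge> 1 \<Longrightarrow> enumerates_polygamma_zeros n (\<eta> n)"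
    and orders: "\<And>n k. n \<ge> 1 \<Longrightarrow> k \<ge> 1 \<Longrightarrow> l n k = polygamma_zero_order n (\<eta> n k)"
  shows
    "(\<forall>n\<ge>1. zero_pole_partial_sum n (l n) (\<eta> n) \<longlonglongrightarrow> 0) \<and>
     (\<forall>n\<ge>1. \<forall>j\<in>{2..n}.
        (\<lambda>k. of_int (l n (Suc k)) / \<eta> n (Suc k) ^ j)
          sums ((-1) ^ j * of_nat (n + 1) * zeta (of_nat j))) \<and>
     (\<forall>n\<ge>1.
        (\<lambda>k. of_int (l (2*n+1) (Suc k)) / \<eta> (2*n+1) (Suc k) ^ (2*n+2)) sums 0 \<and>
        (\<lambda>k. of_int (l (2*n) (Suc k)) / \<eta> (2*n) (Suc k) ^ (2*n+1))
          sums (- 2 * of_nat (2*n+1) * zeta (of_nat (2*n+1))))"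
proof (intro conjI allI impI ballI)
  fix n :: nat assume n: "n \<ge> 1"
  have "zero_pole_partial_sum n (l n) (\<eta> n) = signed_partial_sum n 1 (\<eta> n)"
  proof
    fix K
    have "(\<Sum>k=1..K. of_int (l n k) / \<eta> n k) = (\<Sum>k=1..K. of_int (polygamma_zero_order n (\<eta> n k)) / \<eta> n k ^ 1)"
      using orders[OF n] by (intro sum.cong) auto
    thus "zero_pole_partial_sum n (l n) (\<eta> n) K = signed_partial_sum n 1 (\<eta> n) K"
      unfolding zero_pole_partial_sum_def signed_partial_sum_def 
      by (simp add: sum_distrib_left sum_negf del: of_nat_add of_nat_Suc)
  qed
  \<comment> \<open>Since n >= 1, the exponent 1 is not n + 1 and the residue at 0 vanishes.\<close>
  thus "zero_pole_partial_sum n (l n) (\<eta> n) \<longlonglongrightarrow> 0"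
    using tendsto_signed_partial_sum[OF _ _ _ zeros[OF n], of 1] n by (simp add: polygamma_residue_0_def)
next
  fix n j :: nat assume "n \<ge> 1" "j \<in> {2..n}"
  thus "(\<lambda>k. of_int (l n (Suc k)) / \<eta> n (Suc k) ^ j) sums ((-1) ^ j * of_nat (n + 1) * zeta (of_nat j))"
    using zero_power_sums[of n j, OF _ _ _ zeros] by (simp add: orders polygamma_residue_0_def)
next
  fix n :: nat assume "n \<ge> 1"
  \<comment> \<open>The exponent 2n + 2 is even, so the zeta value from the poles cancels against
    the residue at 0.\<close>
  thus "(\<lambda>k. of_int (l (2*n+1) (Suc k)) / \<eta> (2*n+1) (Suc k) ^ (2*n+2)) sums 0"
    using zero_power_sums[of "2*n+1" "2*n+2", OF _ _ _ zeros] by (simp add: orders polygamma_residue_0_def)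
next
  fix n :: nat assume "n \<ge> 1"
  \<comment> \<open>The exponent 2n + 1 is odd, so both contributions have the same sign and add up
    to the factor -2.\<close>
  thus "(\<lambda>k. of_int (l (2*n) (Suc k)) / \<eta> (2*n) (Suc k) ^ (2*n+1)) sums (- 2 * of_nat (2*n+1) * zeta (of_nat (2*n+1)))"
    using zero_power_sums[of "2*n" "2*n+1", OF _ _ _ zeros] by (simp add: orders polygamma_residue_0_def algebra_simps)
qed

end
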